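(* Let $\mu$ be a nontrivial probability measure on $\partial\mathbb{D}$, $d\mu_t(\theta)=e^{2t\cos\theta}d\mu(\theta)/\int e^{2t\cos\theta}d\mu(\theta)$, $\alpha_n(t)=\alpha_n(\mu_t)$, and $\Theta=\Theta(\mu)$. Suppose $S=\{\theta\in(-\pi,\pi]:|\theta|<\Theta,\ e^{i\theta}\in\mathrm{supp}\,\mu\}$ is finite, with points $\theta_0,\dots,\theta_N$ labeled so that $|\theta_0|\le|\theta_1|\le\cdots\le|\theta_N|$, and that there is a unique point $e^{i\theta_\infty}\in\mathrm{supp}\,\mu$ with $|\theta_\infty|=\Theta$. Set $\theta_{N+1}:=\theta_\infty$. Then, as $t\to\infty$, for $0\le j\le N$: (i) if $|\theta_{j-1}|<|\theta_j|<|\theta_{j+1}|$ (for $j=0$: if $|\theta_0|<|\theta_1|$), then $\alpha_j(t)\to(-1)\prod_{k=0}^j(-e^{-i\theta_k})$; (ii) if $|\theta_j|=|\theta_{j+1}|$, then $\alpha_j(t)\to\bigl[\prod_{k=0}^{j-1}(-e^{-i\theta_k})\bigr][ae^{-i\theta_j}+(1-a)e^{i\theta_j}]$ with $a=\beta_+/(\beta_++\beta_-)$, $\beta_\pm=\prod_{k=0}^{j-1}|e^{\pm i\theta_j}-e^{i\theta_k}|^2\mu(\{e^{\pm i\theta_j}\})$; and for $j\ge N+1$, \[ \alpha_j(t)\to(-1)\Bigl[\prod_{k=0}^N(-e^{-i\theta_k})\Bigr](-e^{-i\theta_\infty})^{j-N}. \]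
   Context: A measure is nontrivial if its support is infinite. Verblunsky coefficients: $\alpha_n(\nu)=-\overline{\Phi_{n+1}(0;\nu)}$ where $\Phi_n(z;\nu)$ are the monic orthogonal polynomials of the probability measure $\nu$ on $\partial\mathbb{D}$. $\sigma_{\mathrm{ess}}(\mu)$ is the set of non-isolated points of $\mathrm{supp}\,\mu$, and $\Theta(\mu)=\min\{|\theta|:\theta\in(-\pi,\pi],\ e^{i\theta}\in\sigma_{\mathrm{ess}}(\mu)\}$. Empty products equal $1$. *)

theory Defs
  imports "HOL-Probability.Probability" "HOL-Computational_Algebra.Polynomial"
begin

definition circle_prob :: "complex measure \<Rightarrow> bool" where
  "circle_prob \<mu> \<longleftrightarrow> prob_space \<mu> \<and> sets \<mu> = sets borel \<and>
     emeasure \<mu> (- sphere 0 1) = 0"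

definition msupp :: "complex measure \<Rightarrow> complex set" where
  "msupp \<mu> = {z. \<forall>e>0. emeasure \<mu> (ball z e) > 0}"

definition nontrivial :: "complex measure \<Rightarrow> bool" where
  "nontrivial \<mu> \<longleftrightarrow> infinite (msupp \<mu>)"

definition ess_supp :: "complex measure \<Rightarrow> complex set" where
  "ess_supp \<mu> = {z \<in> msupp \<mu>. z islimpt msupp \<mu>}"

text \<open>Theta(mu) = min of |theta| over theta in (-pi,pi] with e^(i theta) in the
essential support; Arg takes values in (-pi,pi].\<close>
definition Theta :: "complex measure \<Rightarrow> real" where
  "Theta \<mu> = Inf ((\<lambda>z. \<bar>Arg z\<bar>) ` ess_supp \<mu>)"

definition tilt :: "complex measure \<Rightarrow> real \<Rightarrow> complex measure" where
  "tilt \<mu> t = density \<mu> (\<lambda>z. ennreal (exp (2 * t * Re z) /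
       (\<integral>w. exp (2 * t * Re w) \<partial>\<mu>)))"

definition is_monic_OP :: "complex measure \<Rightarrow> nat \<Rightarrow> complex poly \<Rightarrow> bool" where
  "is_monic_OP \<nu> n p \<longleftrightarrow> degree p = n \<and> lead_coeff p = 1 \<and>
     (\<forall>k<n. (LINT z|\<nu>. poly p z * cnj (z ^ k)) = 0)"

definition monic_OP :: "complex measure \<Rightarrow> nat \<Rightarrow> complex poly" where
  "monic_OP \<nu> n = (THE p. is_monic_OP \<nu> n p)"

definition verblunsky :: "complex measure \<Rightarrow> nat \<Rightarrow> complex" where
  "verblunsky \<nu> n = - cnj (poly (monic_OP \<nu> (Suc n)) 0)"

end

theory Submission
  imports Defs "HOL-Computational_Algebra.Fundamental_Theorem_Algebra"
begin

text \<open>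
  Let \<open>Z\<close> be a finite set of atoms of \<open>\<mu>\<close> lying strictly to the right of the line \<open>Re z = c\<close>, the rest
  of \<open>\<mu>\<close> being carried by \<open>Re z \<le> c\<close>, and let \<open>q = (\<Prod>a\<in>Z. X - a)\<close>. The tilted measure is a multiple of
  \<open>exp (2 t (Re z - c)) \<mu>\<close>. Comparing the monic orthogonal polynomial \<open>\<Phi>\<close> of degree \<open>card Z + m\<close> with
  \<open>q X ^ m\<close>, the minimality of \<open>\<Phi>\<close> forces its values on \<open>Z\<close> to decay exponentially in \<open>t\<close>. Hence
  \<open>\<Phi> = q R + s\<close> with \<open>R\<close> monic of degree \<open>m\<close> and \<open>s\<close> exponentially small, and orthogonality of \<open>\<Phi>\<close> to
  the multiples of \<open>q\<close> only sees the part of \<open>\<mu>\<close> outside \<open>Z\<close>. For \<open>m = 0\<close> this gives (i). For \<open>m = 1\<close>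
  the root of \<open>R\<close> is asymptotically the barycentre of \<open>|q|\<^sup>2 \<mu>\<close> restricted to \<open>Re z = c\<close>, which gives (ii).
  For the last claim a root \<open>u\<close> of \<open>R = (X - u) B\<close> is, up to a small error, the barycentre of
  \<open>|q B|\<^sup>2\<close> times the tilted measure, which concentrates at the single rightmost point outside \<open>Z\<close>;
  that point is a limit point of the support, so \<open>|q B|\<^sup>2\<close> cannot degenerate there.
\<close>

section \<open>Polynomials\<close>

lemma norm_poly_le_sum_coeff:
  fixes p :: "complex poly"
  assumes "cmod z \<le> 1"
  shows "cmod (poly p z) \<le> (\<Sum>i\<le>degree p. cmod (coeff p i))"
proof -
  have "cmod (poly p z) \<le> (\<Sum>i\<le>degree p. cmod (coeff p i * z ^ i))"
    unfolding poly_altdef by (rule norm_sum)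
  also have "\<dots> \<le> (\<Sum>i\<le>degree p. cmod (coeff p i))"
  proof (rule sum_mono)
    fix i
    have "cmod z ^ i \<le> 1" using assms by (simp add: power_le_one)
    then show "cmod (coeff p i * z ^ i) \<le> cmod (coeff p i)"
      by (simp add: norm_mult norm_power mult_left_le)
  qed
  finally show ?thesis .
qed

text \<open>Both sides are polynomials in \<open>x\<close> of degree below \<open>card Z\<close>
  that agree on \<open>Z\<close>. The disjunct \<open>s = 0\<close> matters for empty
  \<open>Z\<close>, since the zero polynomial has degree \<open>0\<close>; the same convention
  recurs below.\<close>

lemma lagrange_interpolation:
  fixes s :: "'a::field poly"
  assumes "finite Z" and "s = 0 \<or> degree s < card Z"
  shows "poly s x = (\<Sum>a\<in>Z. poly s a * (\<Prod>b\<in>Z - {a}. (x - b) / (a - b)))"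
proof (cases "s = 0")
  case False
  define L where "L = (\<Sum>a\<in>Z. smult (poly s a) (\<Prod>b\<in>Z - {a}. smult (inverse (a - b)) [:- b, 1:]))"
  have pL: "poly L y = (\<Sum>a\<in>Z. poly s a * (\<Prod>b\<in>Z - {a}. (y - b) / (a - b)))" for y
    unfolding L_def poly_sum poly_prod poly_smult by (simp add: divide_inverse mult.commute)
  have "poly L a = poly s a" if "a \<in> Z" for a
  proof -
    have "poly L a = (\<Sum>d\<in>Z. if d = a then poly s a else 0)"
      unfolding pL
    proof (rule sum.cong[OF refl])
      fix d assume "d \<in> Z"
      show "poly s d * (\<Prod>b\<in>Z - {d}. (a - b) / (d - b)) = (if d = a then poly s a else 0)"
      proof (cases "d = a")
        case True
        moreover have "(\<Prod>b\<in>Z - {a}. (a - b) / (a - b)) = 1" by (rule prod.neutral) auto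
        ultimately show ?thesis by (simp only: simp_thms if_True mult_1_right)
      next
        case False
        then have "(\<Prod>b\<in>Z - {d}. (a - b) / (d - b)) = 0"
          using that assms(1) by (intro prod_zero) auto
        then show ?thesis using False by simp
      qed
    qed
    then show ?thesis using that assms(1) by simp
  qed
  moreover have "degree L < card Z"
  proof -
    have pos: "card Z > 0" using assms False by auto
    show ?thesis unfolding L_def
    proof (rule degree_sum_less[OF _ pos])
      fix a assume a: "a \<in> Z"
      have "degree (smult (poly s a) (\<Prod>b\<in>Z - {a}. smult (inverse (a - b)) [:- b, 1:]))
          \<le> degree (\<Prod>b\<in>Z - {a}. smult (inverse (a - b)) [:- b, 1:])"
        by (rule degree_smult_le)
      also have "\<dots> \<le> (\<Sum>b\<in>Z - {a}. degree (smult (inverse (a - b)) [:- b, 1:]))"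
        by (rule degree_prod_sum_le[unfolded o_def]) (use assms(1) in simp)
      also have "\<dots> \<le> (\<Sum>b\<in>Z - {a}. 1)"
        by (rule sum_mono) (metis degree_smult_le degree_pCons_eq_if degree_1 one_neq_zero One_nat_def degree_0 pCons_eq_0_iff le_refl zero_neq_one)
      also have "\<dots> < card Z" using a assms(1) pos by simp
      finally show "degree (smult (poly s a) (\<Prod>b\<in>Z - {a}. smult (inverse (a - b)) [:- b, 1:])) < card Z" .
    qed
  qed
  ultimately have "s = L"
    using assms False by (intro poly_eqI_degree[of Z]) auto
  then show ?thesis using pL by metis
qed simp

text \<open>The Lagrange basis is bounded on the closed disc by constants depending on
  \<open>Z\<close> alone. This carries smallness at the atoms over to the whole disc.\<close>

lemma norm_poly_le_values:
  fixes Z :: "complex set"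
  assumes "finite Z"
  obtains C where "C \<ge> 0"
    "\<And>s x. s = 0 \<or> degree s < card Z \<Longrightarrow> cmod x \<le> 1 \<Longrightarrow> cmod (poly s x) \<le> C * (\<Sum>a\<in>Z. cmod (poly s a))"
proof
  define D where "D a = (\<Prod>b\<in>Z - {a}. (1 + cmod b) / cmod (a - b))" for a
  have D0: "D a \<ge> 0" for a unfolding D_def by (intro prod_nonneg) auto
  show "sum D Z \<ge> 0" by (intro sum_nonneg D0)
  fix s :: "complex poly" and x assume s: "s = 0 \<or> degree s < card Z" and x: "cmod x \<le> 1"
  have "cmod (poly s x) \<le> (\<Sum>a\<in>Z. cmod (poly s a * (\<Prod>b\<in>Z - {a}. (x - b) / (a - b))))"
    unfolding lagrange_interpolation[OF assms s, of x] by (rule norm_sum)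
  also have "\<dots> \<le> (\<Sum>a\<in>Z. cmod (poly s a) * sum D Z)"
  proof (rule sum_mono)
    fix a assume a: "a \<in> Z"
    have "cmod (\<Prod>b\<in>Z - {a}. (x - b) / (a - b)) \<le> D a"
      unfolding D_def prod_norm[symmetric] norm_divide
      by (intro prod_mono conjI divide_right_mono order.trans[OF norm_triangle_ineq4])
         (use x in auto)
    also have "D a \<le> sum D Z" using a assms D0 by (intro member_le_sum) auto
    finally show "cmod (poly s a * (\<Prod>b\<in>Z - {a}. (x - b) / (a - b))) \<le> cmod (poly s a) * sum D Z"
      by (simp add: norm_mult mult_left_mono)
  qed
  finally show "cmod (poly s x) \<le> sum D Z * (\<Sum>a\<in>Z. cmod (poly s a))"
    by (simp only: sum_distrib_right[symmetric] mult.commute[of _ "sum D Z"] sum_distrib_left[symmetric])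
qed

text \<open>\<open>poly R 0\<close> is the product of the negated roots. Splitting off one root at a
  time, the factors differ from \<open>- v\<close> by at most \<open>e\<close>, and the errors
  accumulate as in the expansion of \<open>(1 + e) ^ degree R\<close>, because \<open>v\<close> has
  modulus 1.\<close>

lemma monic_poly_near_power:
  fixes R :: "complex poly"
  assumes "lead_coeff R = 1" and "\<And>u. poly R u = 0 \<Longrightarrow> cmod (u - v) \<le> e" and "cmod v = 1" and "e \<ge> 0"
  shows "cmod (poly R 0 - (- v) ^ degree R) \<le> (1 + e) ^ degree R - 1"
  using assms(1,2)
proof (induction "degree R" arbitrary: R)
  case 0
  then have "R = 1" by (auto elim!: degree_eq_zeroE simp: one_pCons)
  then show ?case by simp
next
  case (Suc k)
  have "\<exists>u. poly R u = 0"
    using Suc.hyps(2) by (intro fundamental_theorem_of_algebra) (simp add: constant_degree)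
  then obtain u where u: "poly R u = 0" by blast
  then obtain B where B: "R = [:- u, 1:] * B" by (auto simp: poly_eq_0_iff_dvd)
  have "B \<noteq> 0" using B Suc.hyps(2) by auto
  then have dB: "degree B = k" using Suc.hyps(2) B degree_mult_eq[of "[:-u,1:]" B] by simp
  have lB: "lead_coeff B = 1" using Suc.prems(1) unfolding B lead_coeff_mult by simp
  have IH: "cmod (poly B 0 - (- v) ^ k) \<le> (1 + e) ^ k - 1"
    using Suc.hyps(1)[of B] dB lB Suc.prems(2) B by auto
  have ue: "cmod (u - v) \<le> e" using Suc.prems(2) u by blast
  have "cmod (poly B 0) \<le> cmod (poly B 0 - (- v) ^ k) + cmod ((- v) ^ k)"
    by (metis norm_triangle_sub add.commute)
  then have nB: "cmod (poly B 0) \<le> (1 + e) ^ k" using IH assms(3) by (simp add: norm_power)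
  have "poly R 0 - (- v) ^ degree R = - (u - v) * poly B 0 + (- v) * (poly B 0 - (- v) ^ k)"
    unfolding Suc.hyps(2)[symmetric] by (simp add: B algebra_simps)
  also have "cmod \<dots> \<le> cmod (- (u - v) * poly B 0) + cmod ((- v) * (poly B 0 - (- v) ^ k))"
    by (rule norm_triangle_ineq)
  also have "\<dots> \<le> e * (1 + e) ^ k + 1 * ((1 + e) ^ k - 1)"
    unfolding norm_mult norm_minus_cancel
    by (intro add_mono mult_mono ue nB IH) (use assms in auto)
  finally show ?case unfolding Suc.hyps(2)[symmetric] by (simp add: algebra_simps)
qed

section \<open>Orthogonal polynomials on the unit circle\<close>

text \<open>Finiteness replaces total mass 1, because the weighted and the restricted measures to
  which the theory is applied are not normalised.\<close>

locale circle_measure = finite_measure M for M :: "complex measure" +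
  assumes sets_eq_borel: "sets M = sets borel" and AE_circle: "AE z in M. cmod z = 1"
begin

lemma borel_measurable_M: "borel_measurable M = borel_measurable borel"
  by (intro measurable_cong_sets sets_eq_borel refl)

lemma integrable_bounded_on_circle:
  fixes f :: "complex \<Rightarrow> 'b::{banach, second_countable_topology}"
  assumes "f \<in> borel_measurable borel" and "\<And>z. cmod z = 1 \<Longrightarrow> norm (f z) \<le> B"
  shows "integrable M f"
proof (rule integrable_const_bound[of f B])
  show "AE z in M. norm (f z) \<le> B" using AE_circle assms(2) by (auto elim: eventually_mono)
  show "f \<in> borel_measurable M" using assms(1) by (simp add: borel_measurable_M)
qed

lemma integrable_continuous:
  fixes f :: "complex \<Rightarrow> 'b::euclidean_space"
  assumes "continuous_on UNIV f"
  shows "integrable M f"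
proof -
  have "compact (f ` sphere 0 1)"
    using assms by (intro compact_continuous_image) (auto intro: continuous_on_subset)
  then obtain B where "\<And>x. x \<in> f ` sphere 0 1 \<Longrightarrow> norm x \<le> B"
    using compact_imp_bounded bounded_iff by metis
  then show ?thesis
    using assms by (intro integrable_bounded_on_circle[of f B] borel_measurable_continuous_onI) auto
qed

lemma circle_measure_density:
  fixes g :: "complex \<Rightarrow> real"
  assumes [measurable]: "g \<in> borel_measurable borel" and "\<And>z. g z \<ge> 0" and "\<And>z. cmod z = 1 \<Longrightarrow> g z \<le> B"
  shows "circle_measure (density M g)"
proof -
  have "integrable M g" using assms by (intro integrable_bounded_on_circle[of g B]) auto
  then have "(\<integral>\<^sup>+ z. ennreal (g z) \<partial>M) = ennreal (LINT z|M. g z)"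
    using assms by (intro nn_integral_eq_integral) auto
  moreover have [measurable]: "g \<in> borel_measurable M" by (simp add: borel_measurable_M)
  ultimately have "emeasure (density M g) (space M) \<noteq> \<infinity>"
    by (subst emeasure_density) (auto simp: nn_integral_cong[of M "\<lambda>z. ennreal (g z) * indicator (space M) z" g])
  moreover have "AE z in density M g. cmod z = 1"
    by (subst AE_density) (use AE_circle in \<open>simp_all add: eventually_mono\<close>)
  ultimately show ?thesis
    by (intro circle_measure.intro finite_measureI circle_measure_axioms.intro)
       (simp_all only: space_density sets_density sets_eq_borel simp_thms not_False_eq_True)
qed

definition ip :: "complex poly \<Rightarrow> complex poly \<Rightarrow> complex" where
  "ip p r = (LINT z|M. poly p z * cnj (poly r z))"

definition sqnorm :: "complex poly \<Rightarrow> real" where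
  "sqnorm p = (LINT z|M. (cmod (poly p z))\<^sup>2)"

lemma integrable_ip: "integrable M (\<lambda>z. poly p z * cnj (poly r z))"
  by (intro integrable_continuous continuous_intros)

lemma integrable_sqnorm: "integrable M (\<lambda>z. (cmod (poly p z))\<^sup>2)"
  by (intro integrable_continuous continuous_intros)

lemma ip_self: "ip p p = complex_of_real (sqnorm p)"
  unfolding ip_def sqnorm_def by (simp add: complex_norm_square[symmetric] del: of_real_power)

lemma sqnorm_nonneg: "sqnorm p \<ge> 0"
  unfolding sqnorm_def by simp

lemma cnj_ip: "cnj (ip p r) = ip r p"
proof -
  have "cnj (ip p r) = (LINT z|M. cnj (poly p z * cnj (poly r z)))" 
    unfolding ip_def by (rule Bochner_Integration.integral_cnj[symmetric])
  then show ?thesis unfolding ip_def by (simp add: mult.commute)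
qed

lemma ip_add_left: "ip (p + p') r = ip p r + ip p' r"
  unfolding ip_def by (simp add: algebra_simps Bochner_Integration.integral_add[OF integrable_ip integrable_ip])

lemma ip_smult_left: "ip (smult c p) r = c * ip p r"
  unfolding ip_def by (simp add: mult.assoc)

lemma ip_diff_left: "ip (p - p') r = ip p r - ip p' r"
  using ip_add_left[of p "smult (-1) p'" r] ip_smult_left[of "-1" p' r] by simp

lemma ip_add_right: "ip r (p + p') = ip r p + ip r p'"
  by (metis cnj_ip ip_add_left complex_cnj_add)

lemma ip_smult_right: "ip r (smult c p) = cnj c * ip r p"
  by (metis cnj_ip ip_smult_left complex_cnj_mult)

lemma ip_sum_right: "ip r (sum f A) = (\<Sum>i\<in>A. ip r (f i))"
proof (induction A rule: infinite_finite_induct)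
  case (insert x F) then show ?case by (simp add: ip_add_right)
qed (auto simp: ip_def)

lemma sqnorm_add_orthogonal:
  assumes "ip p r = 0"
  shows "sqnorm (p + r) = sqnorm p + sqnorm r"
proof -
  have "ip r p = 0" using cnj_ip[of p r] assms by simp
  then have "complex_of_real (sqnorm (p + r)) = complex_of_real (sqnorm p + sqnorm r)"
    using assms by (simp add: ip_self[symmetric] ip_add_left ip_add_right)
  then show ?thesis by (simp only: of_real_eq_iff)
qed

lemma sqnorm_smult: "sqnorm (smult c p) = (cmod c)\<^sup>2 * sqnorm p"
  unfolding sqnorm_def by (simp add: norm_mult power_mult_distrib)

lemma is_monic_OP_iff:
  "is_monic_OP M n p \<longleftrightarrow> degree p = n \<and> lead_coeff p = 1 \<and> (\<forall>k<n. ip p (monom 1 k) = 0)"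
  unfolding is_monic_OP_def ip_def by (simp add: poly_monom)

lemma monic_OP_orthogonal:
  assumes "is_monic_OP M n p" and "r = 0 \<or> degree r < n"
  shows "ip p r = 0"
proof (cases "r = 0")
  case False
  then have "ip p (monom c k) = 0" if "k \<le> degree r" for c k
    using assms that ip_smult_right[of p c "monom 1 k"] by (auto simp: is_monic_OP_iff smult_monom)
  then have "ip p (\<Sum>k\<le>degree r. monom (coeff r k) k) = 0"
    unfolding ip_sum_right by (intro sum.neutral) auto
  then show ?thesis by (simp only: poly_as_sum_of_monoms)
qed (simp add: ip_def)

lemma degree_monic_diff:
  fixes p r :: "complex poly"
  assumes "degree p = n" "degree r = n" "lead_coeff p = lead_coeff r"
  shows "p - r = 0 \<or> degree (p - r) < n"
proof -
  have "coeff (p - r) n = 0" using assms by simp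
  moreover have "degree (p - r) \<le> n" using assms by (intro degree_diff_le) auto
  ultimately show ?thesis by (metis leading_coeff_0_iff le_neq_implies_less)
qed

text \<open>\<open>r - p\<close> has degree below \<open>n\<close>, hence is orthogonal to
  \<open>p\<close>, and Pythagoras applies. This extremal property gives both the upper bound at the
  atoms and the lower bound for the mass near the limit point.\<close>

lemma monic_OP_minimal:
  assumes p: "is_monic_OP M n p" and "degree r = n" "lead_coeff r = 1"
  shows "sqnorm p \<le> sqnorm r"
proof -
  have "ip p (r - p) = 0"
    using p assms by (intro monic_OP_orthogonal[OF p] degree_monic_diff) (auto simp: is_monic_OP_def)
  then have "sqnorm (p + (r - p)) = sqnorm p + sqnorm (r - p)" by (rule sqnorm_add_orthogonal)
  then show ?thesis using sqnorm_nonneg[of "r - p"] by simp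
qed

end

section \<open>Definiteness of the norm; existence and uniqueness of orthogonal polynomials\<close>

locale nondegenerate_circle_measure = circle_measure +
  assumes nondegenerate: "(AE z in M. poly p z = 0) \<Longrightarrow> p = 0"
begin

lemma sqnorm_eq_0: "sqnorm p = 0 \<Longrightarrow> p = 0"
  unfolding sqnorm_def
  by (simp add: integral_nonneg_eq_0_iff_AE[OF integrable_sqnorm] nondegenerate)

lemma sqnorm_pos: "p \<noteq> 0 \<Longrightarrow> sqnorm p > 0"
  using sqnorm_eq_0[of p] sqnorm_nonneg[of p] by linarith

lemma monic_OP_unique:
  assumes "is_monic_OP M n p" "is_monic_OP M n r"
  shows "p = r"
proof -
  have d: "p - r = 0 \<or> degree (p - r) < n"
    using assms by (intro degree_monic_diff) (auto simp: is_monic_OP_def)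
  have "ip (p - r) (p - r) = 0"
    using monic_OP_orthogonal[OF assms(1) d] monic_OP_orthogonal[OF assms(2) d] by (simp add: ip_diff_left)
  then show ?thesis using sqnorm_eq_0[of "p - r"] by (simp add: ip_self)
qed

text \<open>Gram-Schmidt: starting from \<open>monom 1 n\<close>, the components along the lower
  orthogonal polynomials are subtracted one at a time, which leaves the leading term alone.\<close>

lemma monic_OP_exists: "\<exists>p. is_monic_OP M n p"
proof (induction n rule: less_induct)
  case (less n)
  then obtain P where P: "\<And>k. k < n \<Longrightarrow> is_monic_OP M k (P k)" by metis
  have "\<exists>p. degree p = n \<and> lead_coeff p = 1 \<and> (\<forall>i<k. ip p (P i) = 0)" if "k \<le> n" for k
    using that
  proof (induction k)
    case 0
    show ?case by (intro exI[of _ "monom 1 n"]) (simp add: degree_monom_eq)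
  next
    case (Suc k)
    then obtain p where p: "degree p = n" "lead_coeff p = 1" "\<And>i. i < k \<Longrightarrow> ip p (P i) = 0" by auto
    define c where "c = ip p (P k) / sqnorm (P k)"
    have Pk: "is_monic_OP M k (P k)" using P Suc by simp
    then have "P k \<noteq> 0" by (auto simp: is_monic_OP_def)
    then have h: "sqnorm (P k) \<noteq> 0" using sqnorm_eq_0 by blast
    have "ip (P k) (P i) = 0" if "i < k" for i
      using that P[of i] Suc.prems by (intro monic_OP_orthogonal[OF Pk]) (auto simp: is_monic_OP_def)
    then have "\<forall>i<Suc k. ip (p - smult c (P k)) (P i) = 0"
      using h by (auto simp: less_Suc_eq ip_diff_left ip_smult_left p ip_self c_def)
    moreover have dl: "degree (smult c (P k)) < n" 
      using Pk Suc.prems degree_smult_le[of c "P k"] by (auto simp: is_monic_OP_def)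
    moreover have "degree (p - smult c (P k)) = n"
      using p dl by (metis degree_add_eq_left degree_minus diff_conv_add_uminus)
    moreover have "coeff (p - smult c (P k)) n = 1"
      using p coeff_eq_0[OF dl] by (metis coeff_diff diff_zero)
    ultimately show ?case by metis
  qed
  from this[of n] obtain p where p: "degree p = n" "lead_coeff p = 1" "\<And>i. i < n \<Longrightarrow> ip p (P i) = 0" by auto
  \<comment> \<open>From orthogonality to the \<open>P k\<close> back to monomials:
    \<open>P k\<close> is monic, so it differs from \<open>monom 1 k\<close> by lower monomials,
    which the induction hypothesis handles.\<close>
  have "ip p (monom 1 k) = 0" if "k < n" for k
    using that
  proof (induction k rule: less_induct)
    case (less k)
    have Pk: "degree (P k) = k" "lead_coeff (P k) = 1" using P[OF less.prems] by (auto simp: is_monic_OP_def)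
    have "P k = (\<Sum>i\<le>k. monom (coeff (P k) i) i)" using poly_as_sum_of_monoms[of "P k"] Pk by simp
    also have "\<dots> = monom 1 k + (\<Sum>i<k. smult (coeff (P k) i) (monom 1 i))"
      using Pk by (simp add: lessThan_Suc_atMost[symmetric] smult_monom add.commute)
    finally have "0 = ip p (monom 1 k + (\<Sum>i<k. smult (coeff (P k) i) (monom 1 i)))"
      using p(3)[OF less.prems] by simp
    also have "\<dots> = ip p (monom 1 k)" 
      using less by (simp add: ip_add_right ip_sum_right ip_smult_right)
    finally show ?case by simp
  qed
  then show ?case using p by (auto simp: is_monic_OP_iff)
qed

lemma is_monic_OP_monic_OP: "is_monic_OP M n (monic_OP M n)"
  unfolding monic_OP_def by (rule theI') (use monic_OP_exists monic_OP_unique in blast)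

text \<open>This replaces compactness of the unit sphere in the space of polynomials of degree below \<open>n\<close>;
  it follows by expanding in orthogonal polynomials.\<close>
lemma norm_poly_le_sqnorm:
  "\<exists>C\<ge>0. \<forall>p z. (p = 0 \<or> degree p < n) \<longrightarrow> cmod z = 1 \<longrightarrow> (cmod (poly p z))\<^sup>2 \<le> C * sqnorm p"
proof (induction n)
  case (Suc n)
  then obtain C where C: "C \<ge> 0" 
    "\<And>p z. p = 0 \<or> degree p < n \<Longrightarrow> cmod z = 1 \<Longrightarrow> (cmod (poly p z))\<^sup>2 \<le> C * sqnorm p" by blast
  define P where "P = monic_OP M n"
  have P: "is_monic_OP M n P" unfolding P_def by (rule is_monic_OP_monic_OP)
  then have dP: "degree P = n" "lead_coeff P = 1" by (auto simp: is_monic_OP_def)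
  then have h: "sqnorm P > 0" by (intro sqnorm_pos) auto
  define S where "S = (\<Sum>i\<le>degree P. cmod (coeff P i))"
  have "(cmod (poly p z))\<^sup>2 \<le> (2 * S\<^sup>2 / sqnorm P + 2 * C) * sqnorm p"
    if p: "p = 0 \<or> degree p < Suc n" and z: "cmod z = 1" for p z
  proof -
    \<comment> \<open>Removing the top coefficient with \<open>P\<close> rather than with a monomial
      makes \<open>r\<close> orthogonal to \<open>P\<close>, so \<open>sqnorm p\<close> controls
      \<open>b\<close> and \<open>r\<close> separately.\<close>
    define b r where "b = coeff p n" and "r = p - smult b P"
    have "coeff r n = 0" using dP by (simp add: r_def b_def)
    moreover have "degree r \<le> n" unfolding r_def
      using p dP by (intro degree_diff_le) (auto intro: order.trans[OF degree_smult_le])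
    ultimately have r: "r = 0 \<or> degree r < n" 
      by (metis leading_coeff_0_iff le_neq_implies_less)
    have pr: "p = smult b P + r" by (simp add: r_def)
    have "ip (smult b P) r = 0" using monic_OP_orthogonal[OF P r] by (simp add: ip_smult_left)
    then have n: "sqnorm p = (cmod b)\<^sup>2 * sqnorm P + sqnorm r"
      unfolding pr by (simp add: sqnorm_add_orthogonal sqnorm_smult)
    have "cmod (poly P z) \<le> S" unfolding S_def using z by (intro norm_poly_le_sum_coeff) auto
    then have S: "(cmod (poly P z))\<^sup>2 \<le> S\<^sup>2" by (intro power_mono) auto
    have "(cmod (poly p z))\<^sup>2 \<le> (cmod (b * poly P z) + cmod (poly r z))\<^sup>2"
      unfolding pr by (intro power_mono) (auto intro: norm_triangle_ineq)
    also have "\<dots> \<le> 2 * (cmod (b * poly P z))\<^sup>2 + 2 * (cmod (poly r z))\<^sup>2"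
      using sum_squares_bound[of "cmod (b * poly P z)" "cmod (poly r z)"] by (simp add: power2_sum)
    also have "\<dots> \<le> 2 * ((cmod b)\<^sup>2 * S\<^sup>2) + 2 * (C * sqnorm r)"
      unfolding norm_mult power_mult_distrib using S C(2)[OF r z]
      by (intro add_mono mult_left_mono) auto
    also have "\<dots> \<le> 2 * S\<^sup>2 / sqnorm P * sqnorm p + 2 * C * sqnorm p"
    proof (rule add_mono)
      have "(cmod b)\<^sup>2 \<le> sqnorm p / sqnorm P" using h n sqnorm_nonneg[of r] by (simp add: field_simps)
      then have "2 * S\<^sup>2 * (cmod b)\<^sup>2 \<le> 2 * S\<^sup>2 * (sqnorm p / sqnorm P)" by (rule mult_left_mono) simp
      then show "2 * ((cmod b)\<^sup>2 * S\<^sup>2) \<le> 2 * S\<^sup>2 / sqnorm P * sqnorm p" by (simp add: mult.commute mult.left_commute)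
      have "sqnorm r \<le> sqnorm p" using n h by simp
      then show "2 * (C * sqnorm r) \<le> 2 * C * sqnorm p" using C(1) by (simp add: mult_left_mono)
    qed
    finally show ?thesis by (simp add: algebra_simps)
  qed
  moreover have "2 * S\<^sup>2 / sqnorm P + 2 * C \<ge> 0" using h C(1) by simp
  ultimately show ?case by blast
next
  case 0
  have "(cmod (poly p z))\<^sup>2 \<le> 0 * sqnorm p" if "p = 0 \<or> degree p < 0" for p z
    using that by simp
  then show ?case by blast
qed

end

lemma (in nondegenerate_circle_measure) nondegenerate_density:
  fixes g :: "complex \<Rightarrow> real"
  assumes [measurable]: "g \<in> borel_measurable borel" and "\<And>z. g z > 0" and "\<And>z. cmod z = 1 \<Longrightarrow> g z \<le> B"
  shows "nondegenerate_circle_measure (density M g)"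
proof -
  interpret D: circle_measure "density M g"
    by (rule circle_measure_density[OF assms(1) less_imp_le[OF assms(2)] assms(3)])
  have g: "(\<lambda>z. ennreal (g z)) \<in> borel_measurable M" by (simp add: borel_measurable_M)
  show ?thesis
  proof (intro nondegenerate_circle_measure.intro D.circle_measure_axioms nondegenerate_circle_measure_axioms.intro)
    fix p assume "AE z in density M g. poly p z = 0"
    then have "AE z in M. poly p z = 0" by (simp add: AE_density[OF g] assms(2))
    then show "p = 0" by (rule nondegenerate)
  qed
qed

section \<open>Asymptotics of the tilted orthogonal polynomials\<close>

text \<open>In the application \<open>Z\<close> holds the first few points
  \<open>cis (\<theta> k)\<close> and \<open>c\<close> is the cosine of the next angle.
  \<open>Z\<close> may be empty, and the line \<open>Re z = c\<close> may carry mass.\<close>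

locale dominant_atoms = nondegenerate_circle_measure +
  fixes Z :: "complex set" and c :: real
  assumes finite_Z: "finite Z"
    and Re_atom: "\<And>a. a \<in> Z \<Longrightarrow> Re a > c"
    and atom_pos: "\<And>a. a \<in> Z \<Longrightarrow> measure M {a} > 0"
    and AE_dominated: "AE z in M. z \<in> Z \<or> Re z \<le> c"
begin

text \<open>The weight is normalised so that it is at most 1 off \<open>Z\<close>; the factor \<open>exp (2 t c)\<close> does not affect
  the monic orthogonal polynomials.\<close>
definition W :: "real \<Rightarrow> complex \<Rightarrow> real" where
  "W t z = exp (2 * t * (Re z - c))"

definition Mt :: "real \<Rightarrow> complex measure" where
  "Mt t = density M (W t)"

definition q :: "complex poly" where
  "q = (\<Prod>a\<in>Z. [:- a, 1:])"

definition \<Phi> :: "nat \<Rightarrow> real \<Rightarrow> complex poly" where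
  "\<Phi> m t = monic_OP (Mt t) (card Z + m)"

definition R :: "nat \<Rightarrow> real \<Rightarrow> complex poly" where
  "R m t = \<Phi> m t div q"

definition s :: "nat \<Rightarrow> real \<Rightarrow> complex poly" where
  "s m t = \<Phi> m t mod q"

lemma W_pos: "W t z > 0"
  by (simp add: W_def)

lemma continuous_W: "continuous_on UNIV (W t)"
  unfolding W_def by (intro continuous_intros)

lemma measurable_W [measurable]: "W t \<in> borel_measurable borel"
  by (intro borel_measurable_continuous_onI continuous_W)

lemma nondegenerate_Mt: "nondegenerate_circle_measure (Mt t)"
  unfolding Mt_def
proof (rule nondegenerate_density[OF measurable_W W_pos])
  fix z :: complex assume "cmod z = 1"
  then have "\<bar>Re z - c\<bar> \<le> 1 + \<bar>c\<bar>"
    using abs_Re_le_cmod[of z] by linarith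
  then have "\<bar>2 * t * (Re z - c)\<bar> \<le> 2 * \<bar>t\<bar> * (1 + \<bar>c\<bar>)"
    by (simp add: abs_mult mult_left_mono)
  then show "W t z \<le> exp (2 * \<bar>t\<bar> * (1 + \<bar>c\<bar>))" unfolding W_def by simp
qed

lemma integral_Mt:
  fixes f :: "complex \<Rightarrow> 'b::euclidean_space"
  assumes "continuous_on UNIV f"
  shows "(LINT z|Mt t. f z) = (LINT z|M. W t z *\<^sub>R f z)"
  unfolding Mt_def
  by (rule integral_density)
     (use assms W_pos in \<open>auto simp: borel_measurable_M less_imp_le borel_measurable_continuous_onI\<close>)

lemma W_le_1: "t \<ge> 0 \<Longrightarrow> Re z \<le> c \<Longrightarrow> W t z \<le> 1"
  unfolding W_def by (simp add: mult_nonneg_nonpos)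

lemma degree_q: "degree q = card Z"
  unfolding q_def by (subst degree_prod_eq_sum_degree) auto

lemma lead_coeff_q: "lead_coeff q = 1"
  unfolding q_def lead_coeff_prod by simp

lemma q_nonzero: "q \<noteq> 0"
  using lead_coeff_q by auto

lemma poly_q: "poly q z = (\<Prod>a\<in>Z. z - a)"
  unfolding q_def by (simp add: poly_prod)

lemma poly_q_atom: "a \<in> Z \<Longrightarrow> poly q a = 0"
  unfolding poly_q using finite_Z by (intro prod_zero) auto

lemma is_monic_OP_\<Phi>: "is_monic_OP (Mt t) (card Z + m) (\<Phi> m t)"
  unfolding \<Phi>_def by (rule nondegenerate_circle_measure.is_monic_OP_monic_OP[OF nondegenerate_Mt])

lemma degree_\<Phi>: "degree (\<Phi> m t) = card Z + m"
  and lead_coeff_\<Phi>: "lead_coeff (\<Phi> m t) = 1"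
  using is_monic_OP_\<Phi>[of t m] by (auto simp: is_monic_OP_def)

lemma \<Phi>_decomp: "\<Phi> m t = q * R m t + s m t"
  unfolding R_def s_def by simp

lemma degree_s: "s m t = 0 \<or> degree (s m t) < card Z"
  unfolding s_def using degree_mod_less[OF q_nonzero, of "\<Phi> m t"] by (simp add: degree_q)

text \<open>The remainder has smaller degree than \<open>\<Phi> m t\<close>, so the leading term of
  \<open>\<Phi> m t\<close> is that of \<open>q * R m t\<close>, and \<open>q\<close> is
  monic.\<close>

lemma degree_R: "degree (R m t) = m" and lead_coeff_R: "lead_coeff (R m t) = 1"
proof -
  have ds: "s m t = 0 \<or> degree (s m t) < degree (\<Phi> m t)"
    using degree_s[of m t] by (auto simp: degree_\<Phi>)
  have eq: "q * R m t = \<Phi> m t - s m t" using \<Phi>_decomp[of m t] by simp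
  have d: "degree (\<Phi> m t - s m t) = card Z + m"
    using ds degree_\<Phi>[of m t] by (metis degree_add_eq_left degree_minus diff_conv_add_uminus diff_zero)
  have "coeff (s m t) (card Z + m) = 0"
    using ds coeff_eq_0[of "s m t"] by (auto simp: degree_\<Phi>)
  then have l: "lead_coeff (q * R m t) = 1"
    unfolding eq d using lead_coeff_\<Phi>[of m t] by (simp add: degree_\<Phi>)
  then show "lead_coeff (R m t) = 1" by (simp add: lead_coeff_mult lead_coeff_q)
  have "R m t \<noteq> 0" using l by auto
  then show "degree (R m t) = m"
    using d unfolding eq[symmetric] by (simp add: degree_mult_eq q_nonzero degree_q)
qed

lemma poly_s_atom: "a \<in> Z \<Longrightarrow> poly (s m t) a = poly (\<Phi> m t) a"
  using \<Phi>_decomp[of m t] by (simp add: poly_q_atom)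

text \<open>A multiple \<open>q * B\<close> with \<open>degree B < m\<close> has degree below that
  of \<open>\<Phi> m t\<close>. Since it vanishes on \<open>Z\<close>, the exponentially large
  weight there drops out of the relation.\<close>

lemma orthogonality:
  assumes "B = 0 \<or> degree B < m"
  shows "(LINT z|M. W t z *\<^sub>R (poly (q * R m t + s m t) z * cnj (poly (q * B) z))) = 0"
proof -
  interpret D: nondegenerate_circle_measure "Mt t" by (rule nondegenerate_Mt)
  have "q * B = 0 \<or> degree (q * B) < card Z + m"
    using assms by (cases "B = 0") (auto simp: degree_mult_eq q_nonzero degree_q)
  then have "D.ip (\<Phi> m t) (q * B) = 0"
    by (rule D.monic_OP_orthogonal[OF is_monic_OP_\<Phi>])
  then show ?thesis
    unfolding D.ip_def by (subst (asm) integral_Mt) (auto simp: \<Phi>_decomp intro!: continuous_intros)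
qed

text \<open>The competitor \<open>q * monom 1 m\<close> vanishes on \<open>Z\<close>, where alone
  the weight exceeds 1, so its weighted norm is bounded in \<open>t\<close>. By minimality so is
  that of \<open>\<Phi> m t\<close>, to which each atom contributes its mass times
  \<open>W t a\<close> times the squared value; this forces the values on \<open>Z\<close> to decay.
  Interpolation does the rest.\<close>

lemma remainder_small:
  obtains C d where "C \<ge> 0" "d > 0"
    "\<And>t x. t \<ge> 0 \<Longrightarrow> cmod x \<le> 1 \<Longrightarrow> cmod (poly (s m t) x) \<le> C * exp (- (d * t))"
proof -
  obtain C0 where C0: "C0 \<ge> 0" "\<And>p x. p = 0 \<or> degree p < card Z \<Longrightarrow> cmod x \<le> 1
      \<Longrightarrow> cmod (poly p x) \<le> C0 * (\<Sum>a\<in>Z. cmod (poly p a))"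
    using norm_poly_le_values[OF finite_Z] by blast
  \<comment> \<open>At most the distance from the atoms to the line \<open>Re z = c\<close>; the
    inserted \<open>1\<close> keeps \<open>Min\<close> meaningful for empty
    \<open>Z\<close>.\<close>
  define d where "d = Min (insert 1 ((\<lambda>a. Re a - c) ` Z))"
  have d: "d > 0" using finite_Z Re_atom by (auto simp: d_def)
  have d_le: "d \<le> Re a - c" if "a \<in> Z" for a
    unfolding d_def using that finite_Z by (intro Min_le) auto
  define Q where "Q = q * monom 1 m"
  have Q: "degree Q = card Z + m" "lead_coeff Q = 1"
  proof -
    have "degree (monom (1::complex) m) = m" by (simp add: degree_monom_eq)
    then show "degree Q = card Z + m" "lead_coeff Q = 1"
      using lead_coeff_mult[of q "monom 1 m"] lead_coeff_q
      by (auto simp: Q_def degree_mult_eq q_nonzero monom_eq_0_iff degree_q)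
  qed
  define K where "K = (\<Sum>i\<le>degree Q. cmod (coeff Q i))"
  define L where "L = K\<^sup>2 * measure M (space M)"
  have atom_le: "cmod (poly (\<Phi> m t) a) \<le> sqrt (L / measure M {a}) * exp (- (d * t))"
    if t: "t \<ge> 0" and a: "a \<in> Z" for t a
  proof -
    interpret D: nondegenerate_circle_measure "Mt t" by (rule nondegenerate_Mt)
    have sq: "D.sqnorm p = (LINT z|M. W t z * (cmod (poly p z))\<^sup>2)" for p
      unfolding D.sqnorm_def by (subst integral_Mt) (auto intro!: continuous_intros)
    have int: "integrable M (\<lambda>z. W t z * (cmod (poly p z))\<^sup>2)" for p
      by (intro integrable_continuous continuous_intros continuous_W)
    have ind: "integrable M (\<lambda>z. indicator {a} z * r)" for r :: real
      by (intro integrable_mult_left integrable_real_indicator) (auto simp: sets_eq_borel emeasure_finite less_top[symmetric])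
    have "measure M {a} * (W t a * (cmod (poly (\<Phi> m t) a))\<^sup>2)
        = (LINT z|M. indicator {a} z * (W t a * (cmod (poly (\<Phi> m t) a))\<^sup>2))"
      by (simp add: sets_eq_borel)
    also have "\<dots> \<le> D.sqnorm (\<Phi> m t)"
      unfolding sq by (intro integral_mono ind int) (auto simp: indicator_def less_imp_le[OF W_pos])
    also have "\<dots> \<le> D.sqnorm Q"
      by (rule D.monic_OP_minimal[OF is_monic_OP_\<Phi> Q])
    also have "\<dots> \<le> (LINT z|M. K\<^sup>2)"
      unfolding sq
    proof (intro integral_mono_AE int integrable_const)
      show "AE z in M. W t z * (cmod (poly Q z))\<^sup>2 \<le> K\<^sup>2"
        using AE_dominated AE_circle
      proof eventually_elim
        case (elim z)
        have "cmod (poly Q z) \<le> K" unfolding K_def using elim by (intro norm_poly_le_sum_coeff) auto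
        then have "(cmod (poly Q z))\<^sup>2 \<le> K\<^sup>2" by (intro power_mono) auto
        moreover have "poly Q z = 0 \<or> W t z \<le> 1"
          using elim W_le_1[OF t] by (auto simp: Q_def poly_q_atom)
        ultimately show ?case
          using W_pos[of t z] mult_mono[of "W t z" 1 "(cmod (poly Q z))\<^sup>2" "K\<^sup>2"] by auto
      qed
    qed
    also have "\<dots> = L" by (simp add: L_def)
    finally have "measure M {a} * (W t a * (cmod (poly (\<Phi> m t) a))\<^sup>2) \<le> L" .
    then have "W t a * (cmod (poly (\<Phi> m t) a))\<^sup>2 \<le> L / measure M {a}"
      using atom_pos[OF a] by (simp add: field_simps)
    moreover have "exp (d * t) ^ 2 \<le> W t a"
      using d_le[OF a] t mult_right_mono[of d "Re a - c" t]
      by (simp add: W_def power2_eq_square exp_add[symmetric] algebra_simps)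
    then have "(exp (d * t) * cmod (poly (\<Phi> m t) a))\<^sup>2 \<le> W t a * (cmod (poly (\<Phi> m t) a))\<^sup>2"
      unfolding power_mult_distrib by (intro mult_right_mono) auto
    ultimately have "exp (d * t) * cmod (poly (\<Phi> m t) a) \<le> sqrt (L / measure M {a})"
      by (intro real_le_rsqrt) linarith
    then show ?thesis by (simp add: exp_minus field_simps)
  qed
  show thesis
  proof (rule that[OF _ d])
    show "C0 * (\<Sum>a\<in>Z. sqrt (L / measure M {a})) \<ge> 0"
      using C0(1) by (intro mult_nonneg_nonneg sum_nonneg) (auto simp: L_def)
    fix t :: real and x :: complex assume t: "t \<ge> 0" and x: "cmod x \<le> 1"
    have "cmod (poly (s m t) x) \<le> C0 * (\<Sum>a\<in>Z. cmod (poly (s m t) a))"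
      by (rule C0(2)[OF degree_s x])
    also have "\<dots> \<le> C0 * (\<Sum>a\<in>Z. sqrt (L / measure M {a}) * exp (- (d * t)))"
      using atom_le[OF t] C0(1) by (intro mult_left_mono sum_mono) (auto simp: poly_s_atom)
    finally show "cmod (poly (s m t) x) \<le> C0 * (\<Sum>a\<in>Z. sqrt (L / measure M {a})) * exp (- (d * t))"
      by (simp add: sum_distrib_right[symmetric] mult.assoc)
  qed
qed

lemma tendsto_exp_decay: "d > 0 \<Longrightarrow> ((\<lambda>t. C * exp (- (d * t))) \<longlongrightarrow> 0) at_top" for C d :: real
  by (intro tendsto_mult_right_zero filterlim_compose[OF exp_at_bot] 
        filterlim_compose[OF filterlim_uminus_at_bot_at_top] filterlim_tendsto_pos_mult_at_top[OF tendsto_const _ filterlim_ident])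

lemma remainder_tendsto_0:
  assumes "cmod x \<le> 1"
  shows "((\<lambda>t. poly (s m t) x) \<longlongrightarrow> 0) at_top"
proof -
  obtain C d where C: "C \<ge> 0" "d > 0"
    "\<And>t x. t \<ge> 0 \<Longrightarrow> cmod x \<le> 1 \<Longrightarrow> cmod (poly (s m t) x) \<le> C * exp (- (d * t))"
    using remainder_small[of m] by blast
  have "\<forall>\<^sub>F t in at_top. cmod (poly (s m t) x) \<le> C * exp (- (d * t))"
    using eventually_ge_at_top[of 0] by eventually_elim (rule C(3)[OF _ assms])
  then show ?thesis by (rule Lim_null_comparison[OF _ tendsto_exp_decay[OF C(2)]])
qed

text \<open>A monic quotient of degree 0 is \<open>1\<close>, so \<open>\<Phi> 0 t\<close> differs
  from \<open>q\<close> by the vanishing remainder only.\<close>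

proposition tendsto_\<Phi>_0: "((\<lambda>t. poly (\<Phi> 0 t) 0) \<longlongrightarrow> poly q 0) at_top"
proof -
  have "R 0 t = 1" for t
    using degree_R[of 0 t] lead_coeff_R[of 0 t] by (auto elim!: degree_eq_zeroE simp: one_pCons)
  then have "poly (\<Phi> 0 t) 0 = poly q 0 + poly (s 0 t) 0" for t
    by (simp add: \<Phi>_decomp)
  then show ?thesis using tendsto_add[OF tendsto_const remainder_tendsto_0[of 0 0]] by simp
qed

section \<open>Integrals against the weight and the case of a linear quotient\<close>

text \<open>Off \<open>Z\<close> the weight is at most 1, and on \<open>Z\<close> the integrand
  vanishes, so the bound is uniform in \<open>t\<close>. It serves for the terms containing the
  remainder \<open>s m t\<close>.\<close>

lemma norm_weighted_integral_le:
  fixes f :: "complex \<Rightarrow> complex"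
  assumes f: "continuous_on UNIV f" "\<And>a. a \<in> Z \<Longrightarrow> f a = 0" and b: "\<And>z. cmod z = 1 \<Longrightarrow> cmod (f z) \<le> b"
    and t: "t \<ge> 0"
  shows "cmod (LINT z|M. W t z *\<^sub>R f z) \<le> b * measure M (space M)"
proof -
  have "cmod (LINT z|M. W t z *\<^sub>R f z) \<le> (LINT z|M. cmod (W t z *\<^sub>R f z))"
    by (rule integral_norm_bound)
  also have "\<dots> \<le> (LINT z|M. b)"
  proof (intro integral_mono_AE integrable_const integrable_continuous continuous_intros continuous_W f)
    show "AE z in M. cmod (W t z *\<^sub>R f z) \<le> b"
      using AE_dominated AE_circle
    proof eventually_elim
      case (elim z)
      have "f z = 0 \<or> W t z \<le> 1" using elim W_le_1[OF t] f(2) by auto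
      then show ?case
        using b[OF elim(2)] W_pos[of t z] mult_mono[of "W t z" 1 "cmod (f z)" b] by auto
    qed
  qed
  finally show ?thesis by (simp add: mult.commute)
qed

text \<open>Dominated convergence: the weight is 1 on the line, tends to 0 to the left of it, and is
  cancelled by \<open>f\<close> on \<open>Z\<close>.\<close>

lemma weighted_integral_tendsto:
  fixes f :: "complex \<Rightarrow> 'b::euclidean_space"
  assumes f: "continuous_on UNIV f" "\<And>a. a \<in> Z \<Longrightarrow> f a = 0"
  shows "((\<lambda>t. LINT z|M. W t z *\<^sub>R f z) \<longlongrightarrow> (LINT z|M. indicator {z. Re z = c} z *\<^sub>R f z)) at_top"
proof (rule integral_dominated_convergence_at_top[where w = "\<lambda>z. norm (f z)"])
  have f_meas [measurable]: "f \<in> borel_measurable borel"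
    by (intro borel_measurable_continuous_onI f)
  have [measurable]: "{z. Re z = c} \<in> sets borel" by measurable
  show "(\<lambda>z. indicator {z. Re z = c} z *\<^sub>R f z) \<in> borel_measurable M"
    unfolding borel_measurable_M by measurable
  show "(\<lambda>z. W t z *\<^sub>R f z) \<in> borel_measurable M" for t
    unfolding borel_measurable_M by measurable
  show "integrable M (\<lambda>z. norm (f z))"
    by (intro integrable_continuous continuous_intros f)
  show "\<forall>\<^sub>F t in at_top. AE z in M. norm (W t z *\<^sub>R f z) \<le> norm (f z)"
    using eventually_ge_at_top[of 0]
  proof eventually_elim
    case (elim t)
    show ?case using AE_dominated
    proof eventually_elim
      case (elim z)
      then have "f z = 0 \<or> W t z \<le> 1" using W_le_1[OF \<open>0 \<le> t\<close>] f(2) by auto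
      then show ?case using W_pos[of t z] by (auto simp: mult_left_le_one_le)
    qed
  qed
  show "AE z in M. ((\<lambda>t. W t z *\<^sub>R f z) \<longlongrightarrow> indicator {z. Re z = c} z *\<^sub>R f z) at_top"
    using AE_dominated
  proof eventually_elim
    case (elim z)
    consider "f z = 0" | "Re z = c" | "Re z < c" using elim f(2) by fastforce
    then show ?case
    proof cases
      case 3
      have "((\<lambda>t. 1 * exp (- (2 * (c - Re z) * t))) \<longlongrightarrow> 0) at_top"
        using 3 by (intro tendsto_exp_decay) simp
      moreover have "W t z = 1 * exp (- (2 * (c - Re z) * t))" for t
        by (simp add: W_def algebra_simps)
      ultimately have "((\<lambda>t. W t z) \<longlongrightarrow> 0) at_top" by simp
      then show ?thesis using 3 tendsto_scaleR[OF _ tendsto_const, of "\<lambda>t. W t z" 0 at_top "f z"] by simp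
    qed (auto simp: W_def)
  qed
qed

text \<open>The quotient is \<open>z - w t\<close>, and orthogonality to \<open>q\<close> reads
  \<open>w t * Dt t = Et t + r t\<close> with \<open>r t\<close> tending to 0. So \<open>w t\<close>
  tends to the barycentre \<open>E / D\<close>; \<open>D \<noteq> 0\<close> says that the line
  carries mass outside the zeros of \<open>q\<close>.\<close>

proposition tendsto_\<Phi>_1:
  defines "D \<equiv> (LINT z|M. indicator {z. Re z = c} z * (cmod (poly q z))\<^sup>2)"
    and "E \<equiv> (LINT z|M. indicator {z. Re z = c} z *\<^sub>R (z * (cmod (poly q z))\<^sup>2))"
  assumes D: "D \<noteq> 0"
  shows "((\<lambda>t. poly (\<Phi> 1 t) 0) \<longlongrightarrow> - poly q 0 * (E / D)) at_top"
proof -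
  obtain C d where C: "C \<ge> 0" "d > 0"
    "\<And>t x. t \<ge> 0 \<Longrightarrow> cmod x \<le> 1 \<Longrightarrow> cmod (poly (s 1 t) x) \<le> C * exp (- (d * t))"
    using remainder_small[of 1] by blast
  define K where "K = (\<Sum>i\<le>degree q. cmod (coeff q i))"
  define w where "w t = - poly (R 1 t) 0" for t
  define Dt where "Dt t = (LINT z|M. W t z *\<^sub>R (cmod (poly q z))\<^sup>2)" for t
  define Et where "Et t = (LINT z|M. W t z *\<^sub>R (z * (cmod (poly q z))\<^sup>2))" for t
  define r where "r t = (LINT z|M. W t z *\<^sub>R (poly (s 1 t) z * cnj (poly q z)))" for t
  have Dt: "(Dt \<longlongrightarrow> D) at_top"
    unfolding Dt_def D_def real_scaleR_def[symmetric]
    by (rule weighted_integral_tendsto) (auto intro!: continuous_intros simp: poly_q_atom)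
  have Et: "(Et \<longlongrightarrow> E) at_top"
    unfolding Et_def E_def
    by (rule weighted_integral_tendsto) (auto intro!: continuous_intros simp: poly_q_atom)
  have r: "(r \<longlongrightarrow> 0) at_top"
  proof (rule Lim_null_comparison[OF _ tendsto_exp_decay[OF C(2), of "C * K * measure M (space M)"]])
    show "\<forall>\<^sub>F t in at_top. cmod (r t) \<le> C * K * measure M (space M) * exp (- (d * t))"
      using eventually_ge_at_top[of 0]
    proof eventually_elim
      case (elim t)
      have "cmod (r t) \<le> (C * exp (- (d * t)) * K) * measure M (space M)"
        unfolding r_def
      proof (rule norm_weighted_integral_le[OF _ _ _ elim])
        fix z :: complex assume "cmod z = 1"
        then show "cmod (poly (s 1 t) z * cnj (poly q z)) \<le> C * exp (- (d * t)) * K"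
          unfolding norm_mult complex_mod_cnj K_def using C elim
          by (intro mult_mono norm_poly_le_sum_coeff C(3)) auto
      qed (auto intro!: continuous_intros simp: poly_q_atom)
      then show ?case by (simp add: mult_ac)
    qed
  qed
  have R: "poly (R 1 t) z = z - w t" for t z
  proof -
    have "R 1 t = [:coeff (R 1 t) 0, coeff (R 1 t) 1:]"
      using degree_R[of 1 t] by (intro poly_eqI) (auto simp: coeff_pCons coeff_eq_0 split: nat.split)
    then have "poly (R 1 t) z = poly [:coeff (R 1 t) 0, 1:] z" "poly (R 1 t) 0 = coeff (R 1 t) 0"
      using lead_coeff_R[of 1 t] degree_R[of 1 t] by (auto simp: poly_0_coeff_0)
    then show ?thesis by (simp add: w_def)
  qed
  have eq: "w t * Dt t = Et t + r t" for t
  proof -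
    have "0 = (LINT z|M. W t z *\<^sub>R (poly (q * R 1 t + s 1 t) z * cnj (poly (q * 1) z)))"
      by (rule orthogonality[symmetric]) simp
    also have "\<dots> = (LINT z|M. W t z *\<^sub>R (z * (cmod (poly q z))\<^sup>2)
        - w t * (W t z *\<^sub>R (cmod (poly q z))\<^sup>2) + W t z *\<^sub>R (poly (s 1 t) z * cnj (poly q z)))"
      by (intro Bochner_Integration.integral_cong refl)
         (simp add: R complex_norm_square algebra_simps scaleR_conv_of_real del: of_real_power One_nat_def)
    also have "\<dots> = Et t - (LINT z|M. w t * (W t z *\<^sub>R (cmod (poly q z))\<^sup>2)) + r t"
      unfolding Et_def r_def
      by (subst Bochner_Integration.integral_add Bochner_Integration.integral_diff;
          (intro integrable_continuous continuous_intros continuous_W)?)+ simp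
    also have "(LINT z|M. w t * (W t z *\<^sub>R (cmod (poly q z))\<^sup>2)) = w t * Dt t"
      unfolding Dt_def by (simp del: of_real_mult of_real_power)
    finally show ?thesis by (simp add: algebra_simps)
  qed
  have "((\<lambda>t. (Et t + r t) / Dt t) \<longlongrightarrow> (E + 0) / D) at_top"
    using D by (intro tendsto_intros Et r Dt) auto
  moreover have "\<forall>\<^sub>F t in at_top. (Et t + r t) / Dt t = w t"
    using tendsto_imp_eventually_ne[OF Dt D]
    by eventually_elim (simp add: eq[symmetric])
  ultimately have "(w \<longlongrightarrow> (E + 0) / D) at_top" by (rule Lim_transform_eventually)
  then have w: "(w \<longlongrightarrow> E / D) at_top" by simp
  have "((\<lambda>t. poly q 0 * (- w t) + poly (s 1 t) 0) \<longlongrightarrow> poly q 0 * (- (E / D)) + 0) at_top"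
    by (intro tendsto_intros w remainder_tendsto_0) simp
  then show ?thesis by (simp add: \<Phi>_decomp R del: One_nat_def)
qed

section \<open>Concentration of the roots of the quotient\<close>

text \<open>For a root \<open>u\<close> with cofactor \<open>B\<close>, testing against
  \<open>G = q * B\<close> expresses \<open>u - v\<close> as a weighted mean of \<open>z - v\<close>
  plus a remainder term. Since \<open>G\<close> varies with \<open>t\<close> and \<open>u\<close>,
  every estimate must be uniform over polynomials of its degree; the restricted measure
  \<open>N\<close> near the line provides this uniformity.\<close>

lemma roots_of_R_near:
  fixes v :: complex
  assumes v: "cmod v = 1"
    and conc: "\<And>e. e > 0 \<Longrightarrow> \<exists>\<delta>>0. AE z in M. z \<in> Z \<or> cmod (z - v) < e \<or> Re z \<le> c - \<delta>"
    and nondeg: "\<And>\<delta>. \<delta> > 0 \<Longrightarrow> nondegenerate_circle_measure (density M (indicator {z. Re z > c - \<delta>}))"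
    and e: "e > 0"
  shows "\<forall>\<^sub>F t in at_top. \<forall>u. poly (R m t) u = 0 \<longrightarrow> cmod (u - v) \<le> e"
proof (cases "m = 0")
  case True
  have "R m t = 1" for t
    using True degree_R[of m t] lead_coeff_R[of m t] by (auto elim!: degree_eq_zeroE simp: one_pCons)
  then show ?thesis by simp
next
  case False
  obtain C1 d where C1: "C1 \<ge> 0" "d > 0"
    "\<And>t x. t \<ge> 0 \<Longrightarrow> cmod x \<le> 1 \<Longrightarrow> cmod (poly (s m t) x) \<le> C1 * exp (- (d * t))"
    using remainder_small[of m] by blast
  obtain \<delta>0 where \<delta>0: "\<delta>0 > 0" "AE z in M. z \<in> Z \<or> cmod (z - v) < e / 2 \<or> Re z \<le> c - \<delta>0"
    using conc[of "e / 2"] e by auto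
  txt \<open>The decay rate \<open>d\<close> of the remainder has to beat the loss \<open>exp (\<delta> t)\<close> in the lower bound for the mass
    near \<open>v\<close>.\<close>
  define \<delta> where "\<delta> = min \<delta>0 (d / 2)"
  have \<delta>: "\<delta> > 0" "\<delta> \<le> d - \<delta>" using \<delta>0 C1 by (auto simp: \<delta>_def)
  have AE_conc: "AE z in M. z \<in> Z \<or> cmod (z - v) < e / 2 \<or> Re z \<le> c - \<delta>"
    using \<delta>0(2) by (rule AE_mp) (auto simp: \<delta>_def)
  \<comment> \<open>With half the margin, the weight is at least
    \<open>exp (- (\<delta> * t))\<close> on \<open>A\<close>, whereas it is at most
    \<open>exp (- (2 * \<delta> * t))\<close> where \<open>Re z \<le> c - \<delta>\<close>. The
    quotient of these rates is what makes the far part negligible.\<close>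
  define A where "A = {z. Re z > c - \<delta> / 2}"
  have A [measurable]: "A \<in> sets borel" unfolding A_def by measurable
  define N where "N = density M (indicator A)"
  interpret N: nondegenerate_circle_measure N
    unfolding N_def A_def using nondeg[of "\<delta> / 2"] \<delta> by simp
  have sqN: "N.sqnorm p = (LINT z|M. indicator A z * (cmod (poly p z))\<^sup>2)" for p
  proof -
    have "(\<lambda>z. (cmod (poly p z))\<^sup>2) \<in> borel_measurable M"
      unfolding borel_measurable_M by (intro borel_measurable_continuous_onI continuous_intros)
    then have "(LINT z|density M (\<lambda>z. ennreal (indicator A z)). (cmod (poly p z))\<^sup>2)
        = (LINT z|M. indicator A z *\<^sub>R (cmod (poly p z))\<^sup>2)"
      by (rule integral_density) (auto simp: borel_measurable_M)
    then show ?thesis unfolding N.sqnorm_def unfolding N_def by (simp add: ennreal_indicator)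
  qed
  obtain C2 where C2: "C2 \<ge> 0"
    "\<And>p z. p = 0 \<or> degree p < card Z + m \<Longrightarrow> cmod z = 1 \<Longrightarrow> (cmod (poly p z))\<^sup>2 \<le> C2 * N.sqnorm p"
    using N.norm_poly_le_sqnorm[of "card Z + m"] by blast
  \<comment> \<open>\<open>card Z + m - 1\<close> is the degree of \<open>G\<close> below, a true
    subtraction since \<open>m\<close> is nonzero here. By minimality \<open>h\<close> bounds the
    squared norm of every such \<open>G\<close> under \<open>N\<close> from below.\<close>
  define h where "h = N.sqnorm (monic_OP N (card Z + m - 1))"
  have P: "is_monic_OP N (card Z + m - 1) (monic_OP N (card Z + m - 1))"
    by (rule N.is_monic_OP_monic_OP)
  then have "monic_OP N (card Z + m - 1) \<noteq> 0" by (auto simp: is_monic_OP_def)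
  then have h: "h > 0" unfolding h_def by (rule N.sqnorm_pos)
  define \<kappa> where "\<kappa> = measure M (space M)"
  have \<kappa>: "\<kappa> \<ge> 0" by (simp add: \<kappa>_def)
  \<comment> \<open>The first summand comes from the far part of \<open>X\<close>, the second from
    the remainder term \<open>Y\<close>.\<close>
  define K where "K = 2 * C2 * \<kappa> + C1 * sqrt (C2 / h) * \<kappa>"
  have root: "cmod (u - v) \<le> e / 2 + K * exp (- (\<delta> * t))"
    if t: "t \<ge> 0" and u: "poly (R m t) u = 0" for t u
  proof -
    obtain B where B: "R m t = [:- u, 1:] * B" using u by (auto simp: poly_eq_0_iff_dvd)
    have B0: "B \<noteq> 0" using lead_coeff_R[of m t] B by auto
    have "m = degree ([:- u, 1:] * B)" by (simp only: B[symmetric] degree_R)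
    also have "\<dots> = Suc (degree B)" using B0 by (subst degree_mult_eq) auto
    finally have dB: "degree B = m - 1" "degree B < m" by auto
    have "lead_coeff ([:- u, 1:] * B) = 1" by (simp only: B[symmetric] lead_coeff_R)
    then have lB: "lead_coeff B = 1" by (simp only: lead_coeff_mult) simp
    define G where "G = q * B"
    have lG: "lead_coeff G = 1" unfolding G_def lead_coeff_mult lead_coeff_q lB by simp
    have dG: "degree G = card Z + m - 1"
      using dB B0 by (simp add: G_def degree_mult_eq q_nonzero degree_q)
    have G_atom: "poly G a = 0" if "a \<in> Z" for a using that by (simp add: G_def poly_q_atom)
    define I where "I = N.sqnorm G"
    define J where "J = (LINT z|M. W t z * (cmod (poly G z))\<^sup>2)"
    have I: "I \<ge> h" unfolding I_def h_def by (rule N.monic_OP_minimal[OF P dG lG])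
    have G_le: "(cmod (poly G z))\<^sup>2 \<le> C2 * I" if "cmod z = 1" for z
      unfolding I_def using that dG False by (intro C2(2)) auto
    have int_J: "integrable M (\<lambda>z. W t z * (cmod (poly G z))\<^sup>2)"
      by (intro integrable_continuous continuous_intros continuous_W)
    have IJ: "exp (- (\<delta> * t)) * I \<le> J"
    proof -
      have "exp (- (\<delta> * t)) * I = (LINT z|M. exp (- (\<delta> * t)) * (indicator A z * (cmod (poly G z))\<^sup>2))"
        unfolding I_def sqN by simp
      also have "\<dots> \<le> J" unfolding J_def
      proof (intro integral_mono int_J)
        have "integrable M (\<lambda>z. indicator A z *\<^sub>R (cmod (poly G z))\<^sup>2)"
          by (intro integrable_mult_indicator integrable_continuous continuous_intros) (simp add: sets_eq_borel)
        then show "integrable M (\<lambda>z. exp (- (\<delta> * t)) * (indicator A z * (cmod (poly G z))\<^sup>2))" by simp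
        fix z
        have "exp (- (\<delta> * t)) \<le> W t z" if "z \<in> A"
          using that t mult_right_mono[of "- \<delta>" "2 * (Re z - c)" t] by (simp add: A_def W_def mult_ac)
        then show "exp (- (\<delta> * t)) * (indicator A z * (cmod (poly G z))\<^sup>2) \<le> W t z * (cmod (poly G z))\<^sup>2"
          using W_pos[of t z] by (auto simp: indicator_def intro!: mult_right_mono)
      qed
      finally show ?thesis .
    qed
    have I_le: "I \<le> exp (\<delta> * t) * J" using IJ by (simp add: exp_minus field_simps)
    have "0 < exp (- (\<delta> * t)) * I" using I h by simp
    then have J: "J > 0" using IJ by linarith
    define X where "X = (LINT z|M. W t z *\<^sub>R ((z - v) * (cmod (poly G z))\<^sup>2))"
    define Y where "Y = (LINT z|M. W t z *\<^sub>R (poly (s m t) z * cnj (poly G z)))"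
    \<comment> \<open>Orthogonality to \<open>G\<close>, with \<open>z - u\<close> written as
      \<open>(z - v) - (u - v)\<close>.\<close>
    have eq: "(u - v) * J = X + Y"
    proof -
      have "0 = (LINT z|M. W t z *\<^sub>R (poly (q * R m t + s m t) z * cnj (poly (q * B) z)))"
        using orthogonality[of B m t] dB by simp
      also have "\<dots> = (LINT z|M. W t z *\<^sub>R ((z - v) * (cmod (poly G z))\<^sup>2)
          - (u - v) * (W t z * (cmod (poly G z))\<^sup>2) + W t z *\<^sub>R (poly (s m t) z * cnj (poly G z)))"
        unfolding B by (intro Bochner_Integration.integral_cong refl)
           (simp add: G_def complex_norm_square algebra_simps scaleR_conv_of_real del: of_real_power)
      also have "\<dots> = X - (LINT z|M. (u - v) * (W t z * (cmod (poly G z))\<^sup>2)) + Y"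
        unfolding X_def Y_def
        by (subst Bochner_Integration.integral_add Bochner_Integration.integral_diff;
            (intro integrable_continuous continuous_intros continuous_W)?)+ simp
      also have "(LINT z|M. (u - v) * (W t z * (cmod (poly G z))\<^sup>2)) = (u - v) * J"
        unfolding J_def by (simp del: of_real_mult of_real_power)
      finally show ?thesis by (simp add: algebra_simps)
    qed
    have X: "cmod X \<le> e / 2 * J + 2 * exp (- (2 * \<delta> * t)) * (C2 * I) * \<kappa>"
    proof -
      have "cmod X \<le> (LINT z|M. cmod (W t z *\<^sub>R ((z - v) * (cmod (poly G z))\<^sup>2)))"
        unfolding X_def by (rule integral_norm_bound)
      also have "\<dots> \<le> (LINT z|M. e / 2 * (W t z * (cmod (poly G z))\<^sup>2) + 2 * exp (- (2 * \<delta> * t)) * (C2 * I))"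
      proof (intro integral_mono_AE integrable_continuous continuous_intros continuous_W)
        show "AE z in M. cmod (W t z *\<^sub>R ((z - v) * (cmod (poly G z))\<^sup>2))
            \<le> e / 2 * (W t z * (cmod (poly G z))\<^sup>2) + 2 * exp (- (2 * \<delta> * t)) * (C2 * I)"
          using AE_conc AE_circle
        proof eventually_elim
          case (elim z)
          define g where "g = (cmod (poly G z))\<^sup>2"
          have g: "0 \<le> g" "g \<le> C2 * I" using G_le elim by (auto simp: g_def)
          have lhs: "cmod (W t z *\<^sub>R ((z - v) * g)) = cmod (z - v) * (W t z * g)"
            using W_pos[of t z] g by (simp add: norm_mult)
          have Wg: "0 \<le> W t z * g" using W_pos[of t z] g by simp
          have "2 * exp (- (2 * \<delta> * t)) * (C2 * I) \<ge> 0" using g by simp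
          moreover consider "z \<in> Z" | "cmod (z - v) < e / 2" | "Re z \<le> c - \<delta>" using elim by auto
          then have "cmod (z - v) * (W t z * g) \<le> e / 2 * (W t z * g)
              \<or> cmod (z - v) * (W t z * g) \<le> 2 * exp (- (2 * \<delta> * t)) * (C2 * I)"
          proof cases
            case 1 then show ?thesis by (simp add: g_def G_atom)
          next
            case 2 then show ?thesis using Wg by (intro disjI1 mult_right_mono) auto
          next
            case 3
            have "W t z \<le> exp (- (2 * \<delta> * t))"
              using 3 t mult_right_mono[of "2 * (Re z - c)" "- (2 * \<delta>)" t] by (simp add: W_def mult_ac)
            then have a: "W t z * g \<le> exp (- (2 * \<delta> * t)) * (C2 * I)" using g by (intro mult_mono) auto
            have b: "cmod (z - v) \<le> 2" using norm_triangle_ineq4[of z v] v elim by simp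
            have "cmod (z - v) * (W t z * g) \<le> 2 * (exp (- (2 * \<delta> * t)) * (C2 * I))"
              by (rule mult_mono[OF b a]) (use Wg in simp_all)
            then show ?thesis by (simp add: mult.assoc)
          qed
          moreover have "0 \<le> e / 2 * (W t z * g)" using e Wg by simp
          ultimately show ?case unfolding g_def[symmetric] lhs by linarith
        qed
      qed
      also have "\<dots> = e / 2 * J + 2 * exp (- (2 * \<delta> * t)) * (C2 * I) * \<kappa>"
        unfolding J_def \<kappa>_def by (subst Bochner_Integration.integral_add[OF integrable_mult_right[OF int_J] integrable_const]) simp
      finally show ?thesis .
    qed
    have Y: "cmod Y \<le> C1 * exp (- (d * t)) * (sqrt (C2 / h) * I) * \<kappa>"
      unfolding Y_def \<kappa>_def
    proof (rule norm_weighted_integral_le[OF _ _ _ t])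
      fix z :: complex assume z: "cmod z = 1"
      \<comment> \<open>\<open>h \<le> I\<close> trades the bound \<open>sqrt (C2 * I)\<close> for
        \<open>G\<close> against one linear in \<open>I\<close>, so that \<open>Y\<close> becomes
        comparable with \<open>J\<close>.\<close>
      have "C2 * I * h \<le> C2 * I * I" using I h C2(1) by (intro mult_left_mono) auto
      then have "C2 * I \<le> C2 / h * I\<^sup>2" using h by (simp add: field_simps power2_eq_square)
      with G_le[OF z] have "(cmod (poly G z))\<^sup>2 \<le> C2 / h * I\<^sup>2" by linarith
      then have "cmod (poly G z) \<le> sqrt (C2 / h * I\<^sup>2)" by (rule real_le_rsqrt)
      also have "\<dots> = sqrt (C2 / h) * I" unfolding real_sqrt_mult using I h by simp
      finally show "cmod (poly (s m t) z * cnj (poly G z)) \<le> C1 * exp (- (d * t)) * (sqrt (C2 / h) * I)"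
        unfolding norm_mult complex_mod_cnj using C1 t z by (intro mult_mono) auto
    qed (auto intro!: continuous_intros simp: G_atom)
    have "cmod (u - v) * J = cmod (X + Y)" using eq J by (metis abs_of_pos norm_mult norm_of_real)
    also have "\<dots> \<le> e / 2 * J + (2 * C2 * \<kappa> * exp (- (2 * \<delta> * t)) + C1 * sqrt (C2 / h) * \<kappa> * exp (- (d * t))) * I"
      using norm_triangle_ineq[of X Y] X Y by (simp add: algebra_simps)
    \<comment> \<open>Since \<open>2 * \<delta> \<le> d\<close>, both errors decay at least like
      \<open>exp (- (2 * \<delta> * t))\<close>; replacing \<open>I\<close> by
      \<open>exp (\<delta> * t) * J\<close> still leaves
      \<open>exp (- (\<delta> * t))\<close>.\<close>
    also have "\<dots> \<le> e / 2 * J + (2 * C2 * \<kappa> * exp (- (2 * \<delta> * t)) + C1 * sqrt (C2 / h) * \<kappa> * exp (- (2 * \<delta> * t))) * (exp (\<delta> * t) * J)"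
    proof -
      have "exp (- (d * t)) \<le> exp (- (2 * \<delta> * t))" using \<delta> t mult_right_mono[of "2 * \<delta>" d t] by simp
      then have "C1 * sqrt (C2 / h) * \<kappa> * exp (- (d * t)) \<le> C1 * sqrt (C2 / h) * \<kappa> * exp (- (2 * \<delta> * t))"
        using C1 C2 h \<kappa> by (intro mult_left_mono) auto
      note add_left_mono[OF mult_mono[OF add_left_mono[OF this] I_le]]
      then show ?thesis using C1 C2 h \<kappa> I by simp
    qed
    also have "\<dots> = (e / 2 + K * exp (- (\<delta> * t))) * J"
    proof -
      have "exp (- (2 * \<delta> * t)) * exp (\<delta> * t) = exp (- (\<delta> * t))" by (simp add: exp_add[symmetric])
      then show ?thesis by (simp add: K_def algebra_simps)
    qed
    finally show ?thesis using J by simp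
  qed
  have "((\<lambda>t. K * exp (- (\<delta> * t))) \<longlongrightarrow> 0) at_top" by (rule tendsto_exp_decay[OF \<delta>(1)])
  then have "\<forall>\<^sub>F t in at_top. K * exp (- (\<delta> * t)) < e / 2" using e by (intro order_tendstoD) auto
  then show ?thesis using eventually_ge_at_top[of 0]
  proof eventually_elim
    case (elim t)
    then show ?case using root[of t] by fastforce
  qed
qed

text \<open>All \<open>m\<close> roots of the quotient tend to \<open>v\<close>, so its value at 0,
  the product of the negated roots, tends to \<open>(- v) ^ m\<close>.\<close>

proposition tendsto_\<Phi>:
  fixes v :: complex
  assumes v: "cmod v = 1"
    and conc: "\<And>e. e > 0 \<Longrightarrow> \<exists>\<delta>>0. AE z in M. z \<in> Z \<or> cmod (z - v) < e \<or> Re z \<le> c - \<delta>"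
    and nondeg: "\<And>\<delta>. \<delta> > 0 \<Longrightarrow> nondegenerate_circle_measure (density M (indicator {z. Re z > c - \<delta>}))"
  shows "((\<lambda>t. poly (\<Phi> m t) 0) \<longlongrightarrow> poly q 0 * (- v) ^ m) at_top"
proof -
  have "((\<lambda>t. poly (R m t) 0) \<longlongrightarrow> (- v) ^ m) at_top"
  proof (rule tendstoI)
    fix \<eta> :: real assume \<eta>: "\<eta> > 0"
    have "((\<lambda>e. (1 + e) ^ m - 1) \<longlongrightarrow> (1 + 0) ^ m - (1::real)) (at_right 0)"
      by (intro tendsto_intros)
    then have "\<forall>\<^sub>F e in at_right 0. (1 + e) ^ m - 1 < \<eta>" using \<eta> by (intro order_tendstoD) auto
    then have "\<forall>\<^sub>F e in at_right 0. 0 < e \<and> (1 + e) ^ m - 1 < \<eta>"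
      using eventually_at_right_less[of "0::real"] by eventually_elim simp
    then obtain e where e: "e > 0" "(1 + e) ^ m - 1 < \<eta>"
      using eventually_happens trivial_limit_at_right_real by blast
    have near: "\<forall>\<^sub>F t in at_top. \<forall>u. poly (R m t) u = 0 \<longrightarrow> cmod (u - v) \<le> e"
      by (rule roots_of_R_near[OF v _ _ e(1)]) (fact conc, fact nondeg)
    show "\<forall>\<^sub>F t in at_top. dist (poly (R m t) 0) ((- v) ^ m) < \<eta>"
      using near
    proof eventually_elim
      case (elim t)
      then have "cmod (poly (R m t) 0 - (- v) ^ degree (R m t)) \<le> (1 + e) ^ degree (R m t) - 1"
        using e v by (intro monic_poly_near_power lead_coeff_R) auto
      then show ?case using e by (simp add: degree_R dist_norm)
    qed
  qed
  then have "((\<lambda>t. poly q 0 * poly (R m t) 0 + poly (s m t) 0) \<longlongrightarrow> poly q 0 * (- v) ^ m + 0) at_top"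
    by (intro tendsto_intros remainder_tendsto_0) simp_all
  then show ?thesis by (simp add: \<Phi>_decomp)
qed

end

section \<open>Support of a measure\<close>

lemma open_compl_msupp:
  assumes sets: "sets \<mu> = sets borel"
  shows "open (- msupp \<mu>)"
proof (rule Topological_Spaces.openI)
  fix z assume "z \<in> - msupp \<mu>"
  then obtain e where e: "e > 0" "emeasure \<mu> (ball z e) = 0" by (auto simp: msupp_def)
  have "ball z e \<subseteq> - msupp \<mu>"
  proof (rule subsetI)
    fix y assume y: "y \<in> ball z e"
    then obtain d where d: "d > 0" "ball y d \<subseteq> ball z e"
      by (rule openE[OF open_ball])
    then have "emeasure \<mu> (ball y d) \<le> emeasure \<mu> (ball z e)"
      by (intro emeasure_mono) (auto simp: sets)
    then show "y \<in> - msupp \<mu>" using d e by (auto simp: msupp_def intro!: exI[of _ d])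
  qed
  then show "\<exists>T. open T \<and> z \<in> T \<and> T \<subseteq> - msupp \<mu>" using e by (intro exI[of _ "ball z e"]) auto
qed

text \<open>The complement is covered by open null sets, and the Lindelof property reduces the cover
  to a countable one.\<close>

lemma emeasure_compl_msupp:
  assumes sets: "sets \<mu> = sets borel"
  shows "emeasure \<mu> (- msupp \<mu>) = 0"
proof -
  define F where "F = {B. open B \<and> emeasure \<mu> B = 0}"
  obtain F' where F': "F' \<subseteq> F" "countable F'" "\<Union>F' = \<Union>F"
    using Lindelof[of F] by (auto simp: F_def)
  have "- msupp \<mu> \<subseteq> \<Union>F"
  proof
    fix z assume "z \<in> - msupp \<mu>"
    then obtain e where "e > 0" "emeasure \<mu> (ball z e) = 0" by (auto simp: msupp_def)
    then show "z \<in> \<Union>F" by (auto simp: F_def intro!: exI[of _ "ball z e"])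
  qed
  moreover have F_null: "\<Union>F' \<in> null_sets \<mu>"
    using F' by (intro null_sets_UN'[of F' "\<lambda>x. x", simplified]) (auto simp: F_def null_sets_def sets)
  ultimately have "- msupp \<mu> \<in> null_sets \<mu>"
    using open_compl_msupp[OF sets] F'(3)
    by (intro null_sets_subset[OF F_null]) (auto simp: sets)
  then show ?thesis by auto
qed

lemma AE_msupp:
  assumes sets: "sets \<mu> = sets borel"
  shows "AE z in \<mu>. z \<in> msupp \<mu>"
proof (rule AE_I')
  show "- msupp \<mu> \<in> null_sets \<mu>"
    using emeasure_compl_msupp[OF sets] open_compl_msupp[OF sets] by (simp add: null_sets_def sets)
qed auto

lemma msupp_subset_closed:
  assumes "closed S" and "emeasure \<mu> (- S) = 0" and sets: "sets \<mu> = sets borel"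
  shows "msupp \<mu> \<subseteq> S"
proof
  fix z assume z: "z \<in> msupp \<mu>"
  show "z \<in> S"
  proof (rule ccontr)
    assume "z \<notin> S"
    then obtain e where e: "e > 0" "ball z e \<subseteq> - S"
      using assms(1) open_contains_ball[of "- S"] by auto
    then have "emeasure \<mu> (ball z e) \<le> emeasure \<mu> (- S)"
      using assms(1) by (intro emeasure_mono) (auto simp: sets)
    then show False using z e assms(2) by (auto simp: msupp_def)
  qed
qed

text \<open>A small ball around \<open>z\<close> meets the support in \<open>z\<close> only, so its
  positive mass sits at \<open>z\<close>.\<close>

lemma emeasure_isolated_point:
  assumes sets: "sets \<mu> = sets borel" and z: "z \<in> msupp \<mu>" "\<not> z islimpt msupp \<mu>"
  shows "emeasure \<mu> {z} > 0"
proof -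
  obtain T where T: "z \<in> T" "open T" "\<And>y. y \<in> msupp \<mu> \<Longrightarrow> y \<in> T \<Longrightarrow> y = z"
    using z(2) by (auto simp: islimpt_def)
  then obtain e where e: "e > 0" "ball z e \<subseteq> T" by (meson open_contains_ball)
  have "emeasure \<mu> (ball z e) = emeasure \<mu> {z}"
  proof (rule emeasure_eq_AE)
    show "AE x in \<mu>. (x \<in> ball z e) = (x \<in> {z})"
      using AE_msupp[OF sets]
    proof eventually_elim
      case (elim x)
      then show ?case using e T(3)[of x] by auto
    qed
  qed (auto simp: sets)
  moreover have "emeasure \<mu> (ball z e) > 0" using z(1) e by (simp add: msupp_def)
  ultimately show ?thesis by simp
qed

text \<open>A nonzero \<open>p\<close> has finitely many roots, so some support point in
  \<open>A\<close> has a ball inside \<open>A\<close> free of roots. That ball would be null,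
  against the definition of the support.\<close>

lemma AE_poly_zero_imp:
  assumes sets: "sets \<mu> = sets borel" and A: "open A" "infinite (A \<inter> msupp \<mu>)"
    and ae: "AE z in \<mu>. z \<in> A \<longrightarrow> poly p z = 0"
  shows "p = 0"
proof (rule ccontr)
  assume "p \<noteq> 0"
  then have fin: "finite {z. poly p z = 0}" by (rule poly_roots_finite)
  then have "infinite (A \<inter> msupp \<mu> - {z. poly p z = 0})" using A(2) by (intro Diff_infinite_finite)
  then have "A \<inter> msupp \<mu> - {z. poly p z = 0} \<noteq> {}" by (rule infinite_imp_nonempty)
  then obtain z where z: "z \<in> A" "z \<in> msupp \<mu>" "poly p z \<noteq> 0" by blast
  have op: "open (A - {z. poly p z = 0})" using fin A(1) by (intro open_Diff finite_imp_closed)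
  have "z \<in> A - {z. poly p z = 0}" using z by simp
  then obtain e where e: "e > 0" "ball z e \<subseteq> A - {z. poly p z = 0}" by (rule openE[OF op])
  have "AE x in \<mu>. x \<notin> ball z e" using ae by eventually_elim (use e in auto)
  then have "ball z e \<in> null_sets \<mu>" by (subst AE_iff_null_sets) (simp_all add: sets)
  then have "emeasure \<mu> (ball z e) = 0" by (rule null_setsD1)
  then show False using z e by (auto simp: msupp_def)
qed

text \<open>Applied to half-planes reaching slightly beyond the vertical line through the limit
  point.\<close>

lemma nondegenerate_restriction:
  assumes "circle_measure \<mu>" and A: "open A" "infinite (A \<inter> msupp \<mu>)"
  shows "nondegenerate_circle_measure (density \<mu> (indicator A))"
proof -
  interpret circle_measure \<mu> by fact
  have "circle_measure (density \<mu> (\<lambda>z. ennreal (indicator A z)))"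
    by (rule circle_measure_density[of _ 1])
      (use A in \<open>auto intro!: borel_measurable_indicator split: split_indicator\<close>)
  then interpret D: circle_measure "density \<mu> (indicator A)"
    by (simp add: ennreal_indicator)
  have ind: "(indicator A :: complex \<Rightarrow> ennreal) \<in> borel_measurable \<mu>"
    using A by (simp add: borel_measurable_M)
  show ?thesis
  proof (intro nondegenerate_circle_measure.intro D.circle_measure_axioms nondegenerate_circle_measure_axioms.intro)
    fix p assume "AE z in density \<mu> (indicator A). poly p z = 0"
    then have "AE z in \<mu>. z \<in> A \<longrightarrow> poly p z = 0"
      unfolding AE_density[OF ind] by eventually_elim (auto simp: indicator_def)
    then show "p = 0" by (rule AE_poly_zero_imp[OF sets_eq_borel A])
  qed
qed

lemma circle_prob_imp_nondegenerate:
  assumes "circle_prob \<mu>" "nontrivial \<mu>"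
  shows "nondegenerate_circle_measure \<mu>"
proof -
  interpret prob_space \<mu> using assms by (simp add: circle_prob_def)
  have sets: "sets \<mu> = sets borel" using assms by (simp add: circle_prob_def)
  have "AE z in \<mu>. cmod z = 1"
    using assms sets by (intro AE_I'[of "- sphere 0 1"]) (auto simp: circle_prob_def null_sets_def)
  moreover have "p = 0" if "AE z in \<mu>. poly p z = 0" for p
    using that assms(2) by (intro AE_poly_zero_imp[OF sets, of UNIV p]) (auto simp: nontrivial_def)
  ultimately show ?thesis using sets by unfold_locales
qed

section \<open>From the tilted probability measures to the shifted weight\<close>

text \<open>The two measures differ by the positive factor \<open>exp (2 * t * c) / Z\<close>, which
  affects no orthogonality relation.\<close>

lemma monic_OP_tilt:
  assumes "circle_prob \<mu>" "nontrivial \<mu>"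
  shows "monic_OP (tilt \<mu> t) n = monic_OP (density \<mu> (\<lambda>z. exp (2 * t * (Re z - c)))) n"
proof -
  interpret nondegenerate_circle_measure \<mu> using assms by (rule circle_prob_imp_nondegenerate)
  interpret prob_space \<mu> using assms by (simp add: circle_prob_def)
  \<comment> \<open>Here \<open>Z\<close> is the normalising integral, not a set of atoms.\<close>
  define Z where "Z = (\<integral>w. exp (2 * t * Re w) \<partial>\<mu>)"
  have int: "integrable \<mu> (\<lambda>w. exp (2 * t * Re w))"
    by (intro integrable_continuous continuous_intros)
  have "Z \<noteq> 0"
    unfolding Z_def by (subst integral_nonneg_eq_0_iff_AE[OF int]) auto
  moreover have "Z \<ge> 0" unfolding Z_def by simp
  ultimately have Z: "Z > 0" by simp
  have meas: "(\<lambda>z. exp (2 * t * Re z) / Z) \<in> borel_measurable \<mu>"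
    "(\<lambda>z. exp (2 * t * (Re z - c))) \<in> borel_measurable \<mu>"
    unfolding borel_measurable_M by (intro borel_measurable_continuous_onI continuous_intros; use Z in simp)+
  have scale: "(LINT z|tilt \<mu> t. f z) = (exp (2 * t * c) / Z :: real) *\<^sub>R (LINT z|density \<mu> (\<lambda>z. exp (2 * t * (Re z - c))). f z)"
    if f: "continuous_on UNIV f" for f :: "complex \<Rightarrow> complex"
  proof -
    have f': "f \<in> borel_measurable \<mu>" unfolding borel_measurable_M by (rule borel_measurable_continuous_onI[OF f])
    have "(LINT z|tilt \<mu> t. f z) = (LINT z|\<mu>. (exp (2 * t * Re z) / Z) *\<^sub>R f z)"
      unfolding tilt_def Z_def[symmetric] using Z by (intro integral_density f' meas) auto
    also have "\<dots> = (LINT z|\<mu>. (exp (2 * t * c) / Z) *\<^sub>R (exp (2 * t * (Re z - c)) *\<^sub>R f z))"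
      by (intro Bochner_Integration.integral_cong refl) (simp add: algebra_simps exp_diff)
    also have "\<dots> = (exp (2 * t * c) / Z :: real) *\<^sub>R (LINT z|\<mu>. exp (2 * t * (Re z - c)) *\<^sub>R f z)"
      by (rule integral_scaleR_right)
    also have "(LINT z|\<mu>. exp (2 * t * (Re z - c)) *\<^sub>R f z) = (LINT z|density \<mu> (\<lambda>z. exp (2 * t * (Re z - c))). f z)"
      by (intro integral_density[symmetric] f' meas) auto
    finally show ?thesis .
  qed
  have "(LINT z|tilt \<mu> t. poly p z * cnj (z ^ k)) = 0 \<longleftrightarrow>
      (LINT z|density \<mu> (\<lambda>z. exp (2 * t * (Re z - c))). poly p z * cnj (z ^ k)) = 0" for p k
    using Z by (subst scale) (auto intro!: continuous_intros)
  then show ?thesis unfolding monic_OP_def is_monic_OP_def by simp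
qed

lemma verblunsky_tendsto:
  assumes "circle_prob \<mu>" "nontrivial \<mu>"
    and "((\<lambda>t. poly (monic_OP (density \<mu> (\<lambda>z. exp (2 * t * (Re z - c)))) (Suc j)) 0) \<longlongrightarrow> l) at_top"
    and "L = - cnj l"
  shows "((\<lambda>t. verblunsky (tilt \<mu> t) j) \<longlongrightarrow> L) at_top"
  unfolding verblunsky_def monic_OP_tilt[OF assms(1,2), of _ _ c] assms(4)
  by (rule tendsto_minus[OF tendsto_cnj[OF assms(3)]])

section \<open>Angles, real parts and vertical lines\<close>

text \<open>The cosine is even and decreasing on \<open>[0, pi]\<close>. This turns the ordering of
  points by absolute angle into the ordering by real part.\<close>

lemma cos_le_cos_iff_abs:
  assumes "\<bar>x\<bar> \<le> pi" "\<bar>y\<bar> \<le> pi"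
  shows "cos x \<le> cos y \<longleftrightarrow> \<bar>y\<bar> \<le> \<bar>x\<bar>"
proof (cases "\<bar>x\<bar> < \<bar>y\<bar>")
  case True
  then show ?thesis using cos_monotone_0_pi[of "\<bar>x\<bar>" "\<bar>y\<bar>"] assms by simp
next
  case False
  then show ?thesis using cos_monotone_0_pi_le[of "\<bar>y\<bar>" "\<bar>x\<bar>"] assms by simp
qed

lemma cis_eq_iff_principal:
  assumes "-pi < x" "x \<le> pi" "-pi < y" "y \<le> pi"
  shows "cis x = cis y \<longleftrightarrow> x = y"
  using Arg_cis[of x] Arg_cis[of y] assms by (metis greaterThanAtMost_iff)

lemma cos_less_cos_iff_abs:
  assumes "\<bar>x\<bar> \<le> pi" "\<bar>y\<bar> \<le> pi"
  shows "cos x < cos y \<longleftrightarrow> \<bar>y\<bar> < \<bar>x\<bar>"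
  using cos_le_cos_iff_abs[OF assms(2,1)] by linarith

lemma unit_circle_Re_eq_cos:
  assumes "cmod z = 1" "Re z = cos x"
  shows "z = cis x \<or> z = cis (- x)"
proof -
  have "(Re z)\<^sup>2 + (Im z)\<^sup>2 = 1" using assms(1) by (simp add: cmod_power2[symmetric])
  then have "(Im z)\<^sup>2 = (sin x)\<^sup>2"
    using sin_cos_squared_add[of x] unfolding assms(2) by linarith
  then show ?thesis using assms(2) by (auto simp: power2_eq_iff complex_eq_iff)
qed

text \<open>The line meets the circle in a conjugate pair; the hypothesis on \<open>x\<close> keeps
  the two points apart, so that no atom is counted twice.\<close>

lemma (in circle_measure) integral_vertical_line:
  fixes f :: "complex \<Rightarrow> 'b::euclidean_space"
  assumes f: "continuous_on UNIV f" and x: "cis x \<noteq> cis (- x)"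
  shows "(LINT z|M. indicator {z. Re z = cos x} z *\<^sub>R f z)
    = measure M {cis x} *\<^sub>R f (cis x) + measure M {cis (- x)} *\<^sub>R f (cis (- x))"
proof -
  have f_meas [measurable]: "f \<in> borel_measurable borel" by (rule borel_measurable_continuous_onI[OF f])
  have [measurable]: "{z. Re z = cos x} \<in> sets borel" by measurable
  have ind0: "integrable M (indicator {a} :: complex \<Rightarrow> real)" for a
    by (intro integrable_real_indicator) (auto simp: sets_eq_borel emeasure_finite less_top[symmetric])
  then have ind: "integrable M (\<lambda>z. indicator {a} z *\<^sub>R b)" for a and b :: 'b
    by (intro integrable_scaleR_left)
  have atom: "(LINT z|M. indicator {a} z *\<^sub>R b) = measure M {a} *\<^sub>R b" for a and b :: 'b
    using ind0 by (subst integral_scaleR_left) (simp_all add: sets_eq_imp_space_eq[OF sets_eq_borel])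
  have "(LINT z|M. indicator {z. Re z = cos x} z *\<^sub>R f z)
      = (LINT z|M. indicator {cis x} z *\<^sub>R f (cis x) + indicator {cis (- x)} z *\<^sub>R f (cis (- x)))"
  proof (rule integral_cong_AE)
    show "AE z in M. indicator {z. Re z = cos x} z *\<^sub>R f z
        = indicator {cis x} z *\<^sub>R f (cis x) + indicator {cis (- x)} z *\<^sub>R f (cis (- x))"
      using AE_circle
    proof eventually_elim
      case (elim z)
      then show ?case using unit_circle_Re_eq_cos[OF elim, of x] x by (auto simp: indicator_def)
    qed
  qed (unfold borel_measurable_M, measurable)
  also have "\<dots> = measure M {cis x} *\<^sub>R f (cis x) + measure M {cis (- x)} *\<^sub>R f (cis (- x))"
    by (simp only: Bochner_Integration.integral_add[OF ind ind] atom)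
  finally show ?thesis .
qed

section \<open>Verification of the hypotheses and the three limits\<close>

theorem theorem7p2:
  fixes \<mu> :: "complex measure" and N :: nat and \<theta> :: "nat \<Rightarrow> real"
    and \<theta>inf :: real
  assumes mu: "circle_prob \<mu>" and nt: "nontrivial \<mu>"
    and S: "{\<phi>. -pi < \<phi> \<and> \<phi> \<le> pi \<and> \<bar>\<phi>\<bar> < Theta \<mu> \<and> cis \<phi> \<in> msupp \<mu>} = \<theta> ` {..N}"
    and inj: "inj_on \<theta> {..N}"
    and sorted: "\<And>k. k < N \<Longrightarrow> \<bar>\<theta> k\<bar> \<le> \<bar>\<theta> (Suc k)\<bar>"
    and inf_range: "-pi < \<theta>inf" "\<theta>inf \<le> pi"
    and inf_abs: "\<bar>\<theta>inf\<bar> = Theta \<mu>" and inf_supp: "cis \<theta>inf \<in> msupp \<mu>"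
    and inf_unique: "\<And>\<phi>. -pi < \<phi> \<Longrightarrow> \<phi> \<le> pi \<Longrightarrow> \<bar>\<phi>\<bar> = Theta \<mu> \<Longrightarrow>
                         cis \<phi> \<in> msupp \<mu> \<Longrightarrow> \<phi> = \<theta>inf"
  defines "\<theta>' \<equiv> (\<lambda>k. if k \<le> N then \<theta> k else \<theta>inf)"
  shows
   "(\<forall>j\<le>N. (j = 0 \<or> \<bar>\<theta> (j - 1)\<bar> < \<bar>\<theta> j\<bar>) \<and> \<bar>\<theta> j\<bar> < \<bar>\<theta>' (Suc j)\<bar> \<longrightarrow>
        ((\<lambda>t. verblunsky (tilt \<mu> t) j) \<longlongrightarrow>
           (-1) * (\<Prod>k\<le>j. - cis (- \<theta> k))) at_top)
  \<and> (\<forall>j\<le>N. \<bar>\<theta> j\<bar> = \<bar>\<theta>' (Suc j)\<bar> \<longrightarrow>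
        (let \<beta>p = (\<Prod>k<j. (cmod (cis (\<theta> j) - cis (\<theta> k)))\<^sup>2) * measure \<mu> {cis (\<theta> j)};
             \<beta>m = (\<Prod>k<j. (cmod (cis (- \<theta> j) - cis (\<theta> k)))\<^sup>2) * measure \<mu> {cis (- \<theta> j)};
             a = \<beta>p / (\<beta>p + \<beta>m)
         in ((\<lambda>t. verblunsky (tilt \<mu> t) j) \<longlongrightarrow>
           (\<Prod>k<j. - cis (- \<theta> k)) *
             (complex_of_real a * cis (- \<theta> j) + complex_of_real (1 - a) * cis (\<theta> j))) at_top))
  \<and> (\<forall>j\<ge>Suc N.
        ((\<lambda>t. verblunsky (tilt \<mu> t) j) \<longlongrightarrow>
           (-1) * (\<Prod>k\<le>N. - cis (- \<theta> k)) * (- cis (- \<theta>inf)) ^ (j - N)) at_top)"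
proof -
  interpret nondegenerate_circle_measure \<mu> using mu nt by (rule circle_prob_imp_nondegenerate)
  note sets = sets_eq_borel
  let ?T = "msupp \<mu>"
  have T_sphere: "?T \<subseteq> sphere 0 1"
    using mu by (intro msupp_subset_closed sets) (auto simp: circle_prob_def)
  have T_closed: "closed ?T" using open_compl_msupp[OF sets] by (simp add: closed_def)
  have T_compact: "compact ?T"
    using T_closed T_sphere by (metis bounded_sphere bounded_subset compact_eq_bounded_closed)
  have cis_Arg_T: "cis (Arg z) = z" "Re z = cos (Arg z)" if "z \<in> ?T" for z
  proof -
    have "cmod z = 1" using T_sphere that by auto
    moreover from this have "z \<noteq> 0" by auto
    ultimately show "cis (Arg z) = z" using cis_Arg[of z] by (simp add: sgn_div_norm)
    then show "Re z = cos (Arg z)" by (metis cis.simps(1))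
  qed
  have abs_Arg: "\<bar>Arg z\<bar> \<le> pi" for z using Arg_bounded[of z] by linarith

  have \<theta>: "-pi < \<theta> k" "\<theta> k \<le> pi" "\<bar>\<theta> k\<bar> < Theta \<mu>" "cis (\<theta> k) \<in> ?T" if "k \<le> N" for k
    using S that by auto
  have Theta_le: "Theta \<mu> \<le> pi" using inf_range inf_abs by linarith
  have abs_\<theta>': "\<bar>\<theta>' k\<bar> \<le> Theta \<mu>" for k
    using \<theta>(3)[of k] inf_abs by (auto simp: \<theta>'_def)
  then have abs_\<theta>'_pi: "\<bar>\<theta>' k\<bar> \<le> pi" for k using Theta_le order.trans by blast
  have abs_\<theta>_pi: "\<bar>\<theta> k\<bar> \<le> pi" if "k \<le> N" for k using \<theta>(3)[OF that] Theta_le by linarith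
  have mono: "\<bar>\<theta> i\<bar> \<le> \<bar>\<theta> k\<bar>" if "i \<le> k" "k \<le> N" for i k
    using that
  proof (induction k rule: dec_induct)
    case (step k) then show ?case using sorted[of k] by linarith
  qed simp
  have inj_cis: "inj_on (\<lambda>k. cis (\<theta> k)) {..N}"
  proof (rule inj_onI)
    fix i k assume "i \<in> {..N}" "k \<in> {..N}" "cis (\<theta> i) = cis (\<theta> k)"
    then show "i = k" using cis_eq_iff_principal[of "\<theta> i" "\<theta> k"] \<theta> inj by (auto dest: inj_onD)
  qed

  have Theta_le_Arg: "Theta \<mu> \<le> \<bar>Arg z\<bar>" if "z \<in> ess_supp \<mu>" for z
    unfolding Theta_def using that by (intro cInf_lower bdd_belowI[of _ 0]) auto
  \<comment> \<open>A support point with angle below \<open>Theta \<mu>\<close> in absolute value is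
    not in the essential support, hence is isolated and charged.\<close>
  have atom: "measure \<mu> {cis (\<theta> k)} > 0" if "k \<le> N" for k
  proof -
    have "\<not> cis (\<theta> k) islimpt ?T"
      using Theta_le_Arg[of "cis (\<theta> k)"] \<theta>[OF that] Arg_cis[of "\<theta> k"] by (auto simp: ess_supp_def)
    then have "emeasure \<mu> {cis (\<theta> k)} > 0" using \<theta>[OF that] by (intro emeasure_isolated_point sets) auto
    then show ?thesis by (simp add: emeasure_eq_measure)
  qed

  define v where "v = cis \<theta>inf"
  \<comment> \<open>The infimum in \<open>Theta\<close> is attained: \<open>ess_supp \<mu>\<close>
    is compact, and nonempty by Bolzano-Weierstrass. Maximising the continuous function
    \<open>Re\<close> replaces minimising the absolute angle, and \<open>inf_unique\<close>
    identifies the maximiser.\<close>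
  have v_limit: "v islimpt ?T"
  proof -
    have "\<exists>x\<in>?T. x islimpt ?T"
      using T_compact nt by (intro Heine_Borel_imp_Bolzano_Weierstrass) (auto simp: nontrivial_def)
    then have ne: "ess_supp \<mu> \<noteq> {}" by (auto simp: ess_supp_def)
    have "ess_supp \<mu> = ?T \<inter> {x. x islimpt ?T}" by (auto simp: ess_supp_def)
    then have "compact (ess_supp \<mu>)" using T_compact by (simp add: compact_Int_closed closed_limpts)
    then obtain x where x: "x \<in> ess_supp \<mu>" "\<And>y. y \<in> ess_supp \<mu> \<Longrightarrow> Re y \<le> Re x"
      using continuous_attains_sup[of "ess_supp \<mu>" Re] ne continuous_on_Re[OF continuous_on_id] by auto
    have xT: "x \<in> ?T" using x by (simp add: ess_supp_def)
    have "\<bar>Arg x\<bar> \<le> \<bar>Arg y\<bar>" if y: "y \<in> ess_supp \<mu>" for y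
    proof -
      have "y \<in> ?T" using y by (simp add: ess_supp_def)
      then have "cos (Arg y) \<le> cos (Arg x)" using x(2)[OF y] cis_Arg_T(2) xT by metis
      then show ?thesis using cos_le_cos_iff_abs[OF abs_Arg abs_Arg] by blast
    qed
    then have "\<bar>Arg x\<bar> \<le> Theta \<mu>" unfolding Theta_def using ne by (intro cInf_greatest) auto
    then have "Arg x = \<theta>inf"
      using Theta_le_Arg[OF x(1)] Arg_bounded[of x] xT cis_Arg_T(1)[OF xT] by (intro inf_unique) auto
    then have "x = v" using cis_Arg_T(1)[OF xT] by (simp add: v_def)
    then show ?thesis using x by (simp add: ess_supp_def)
  qed

  have T_cases: "(\<exists>k\<le>N. z = cis (\<theta> k)) \<or> Re z \<le> cos (Theta \<mu>)" if "z \<in> ?T" for z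
  proof (cases "\<bar>Arg z\<bar> < Theta \<mu>")
    case True
    then have "Arg z \<in> \<theta> ` {..N}"
      unfolding S[symmetric] using Arg_bounded[of z] that cis_Arg_T(1)[OF that] by simp
    then show ?thesis using cis_Arg_T(1)[OF that] by fastforce
  next
    case False
    then show ?thesis
      using cos_le_cos_iff_abs[OF abs_Arg[of z], of "Theta \<mu>"] Theta_le inf_abs cis_Arg_T(2)[OF that] by auto
  qed

  define Z where "Z j = (\<lambda>k. cis (\<theta> k)) ` {..<j}" for j
  have card_Z: "card (Z j) = j" if "j \<le> Suc N" for j
    unfolding Z_def using that by (subst card_image) (auto intro: inj_on_subset[OF inj_cis])
  have prod_Z: "(\<Prod>a\<in>Z j. f a) = (\<Prod>k<j. f (cis (\<theta> k)))" if "j \<le> Suc N" for j and f :: "complex \<Rightarrow> complex"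
    unfolding Z_def using that by (subst prod.reindex) (auto intro: inj_on_subset[OF inj_cis])
  \<comment> \<open>The atoms are the first \<open>j\<close> points, strictly to the right of the
    line by \<open>less\<close>. The later points lie on or to the left of it by monotonicity, the
    rest of the support by \<open>T_cases\<close>.\<close>
  have dominant: "dominant_atoms \<mu> (Z j) (cos (\<theta>' j))"
    if j: "j \<le> Suc N" and less: "\<And>k. k < j \<Longrightarrow> \<bar>\<theta> k\<bar> < \<bar>\<theta>' j\<bar>" for j
  proof
    show "finite (Z j)" by (simp add: Z_def)
    fix a assume "a \<in> Z j"
    then obtain k where k: "k < j" "a = cis (\<theta> k)" by (auto simp: Z_def)
    then show "cos (\<theta>' j) < Re a"
      using cos_less_cos_iff_abs[OF abs_\<theta>'_pi[of j] abs_\<theta>_pi[of k]] less[of k] j by simp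
    show "measure \<mu> {a} > 0" using k atom j by simp
  next
    show "AE z in \<mu>. z \<in> Z j \<or> Re z \<le> cos (\<theta>' j)"
      using AE_msupp[OF sets]
    proof eventually_elim
      case (elim z)
      consider k where "k < j" "z = cis (\<theta> k)" | k where "j \<le> k" "k \<le> N" "z = cis (\<theta> k)"
        | "Re z \<le> cos (Theta \<mu>)"
        using T_cases[OF elim] by (metis linorder_not_less)
      then show ?case
      proof cases
        case (2 k)
        then have "cos (\<theta> k) \<le> cos (\<theta> j)"
          using mono cos_le_cos_iff_abs abs_\<theta>_pi by (meson order.trans)
        then show ?thesis using 2 by (simp add: \<theta>'_def)
      next
        case 3
        have "cos (Theta \<mu>) \<le> cos (\<theta>' j)"
          using cos_le_cos_iff_abs[of "Theta \<mu>" "\<theta>' j"] abs_\<theta>'[of j] abs_\<theta>'_pi[of j] Theta_le inf_abs by auto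
        then show ?thesis using 3 by simp
      qed (auto simp: Z_def)
    qed
  qed
  have cnj_q: "cnj (poly (dominant_atoms.q (Z j)) 0) = (\<Prod>k<j. - cis (- \<theta> k))"
    if j: "j \<le> Suc N" and "dominant_atoms \<mu> (Z j) (cos (\<theta>' j))" for j
    using prod_Z[OF j, of "\<lambda>a. 0 - a"] dominant_atoms.poly_q[OF that(2), of 0] by (simp add: cis_cnj)

  have part1: "((\<lambda>t. verblunsky (tilt \<mu> t) j) \<longlongrightarrow> (-1) * (\<Prod>k\<le>j. - cis (- \<theta> k))) at_top"
    if j: "j \<le> N" and less: "\<bar>\<theta> j\<bar> < \<bar>\<theta>' (Suc j)\<bar>" for j
  proof -
    \<comment> \<open>The coefficient of index \<open>j\<close> comes from the polynomial of degree
      \<open>Suc j\<close>, so taking the first \<open>Suc j\<close> points as atoms gives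
      \<open>m = 0\<close>.\<close>
    have "\<bar>\<theta> k\<bar> < \<bar>\<theta>' (Suc j)\<bar>" if "k < Suc j" for k
      using that mono[of k j] j less by simp
    then have da: "dominant_atoms \<mu> (Z (Suc j)) (cos (\<theta>' (Suc j)))" using j by (intro dominant) auto
    then interpret D: dominant_atoms \<mu> "Z (Suc j)" "cos (\<theta>' (Suc j))" .
    have "((\<lambda>t. poly (monic_OP (density \<mu> (\<lambda>z. exp (2 * t * (Re z - cos (\<theta>' (Suc j)))))) (Suc j)) 0)
        \<longlongrightarrow> poly D.q 0) at_top"
      using D.tendsto_\<Phi>_0 j by (simp add: D.\<Phi>_def D.Mt_def D.W_def card_Z)
    then show ?thesis
      by (rule verblunsky_tendsto[OF mu nt]) (use cnj_q[OF _ da] j in \<open>simp add: lessThan_Suc_atMost\<close>)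
  qed

  have part2: "(let \<beta>p = (\<Prod>k<j. (cmod (cis (\<theta> j) - cis (\<theta> k)))\<^sup>2) * measure \<mu> {cis (\<theta> j)};
             \<beta>m = (\<Prod>k<j. (cmod (cis (- \<theta> j) - cis (\<theta> k)))\<^sup>2) * measure \<mu> {cis (- \<theta> j)};
             a = \<beta>p / (\<beta>p + \<beta>m)
         in ((\<lambda>t. verblunsky (tilt \<mu> t) j) \<longlongrightarrow>
           (\<Prod>k<j. - cis (- \<theta> k)) *
             (complex_of_real a * cis (- \<theta> j) + complex_of_real (1 - a) * cis (\<theta> j))) at_top)"
    if j: "j \<le> N" and eq: "\<bar>\<theta> j\<bar> = \<bar>\<theta>' (Suc j)\<bar>" for j
  proof -
    \<comment> \<open>Equality with the point at infinity is excluded by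
      \<open>\<bar>\<theta> j\<bar> < Theta \<mu>\<close>, so \<open>\<theta> (Suc j)\<close> is a
      genuine point, and by injectivity it is \<open>- \<theta> j\<close>.\<close>
    have jN: "Suc j \<le> N" using \<theta>(3)[OF j] eq inf_abs by (auto simp: \<theta>'_def split: if_splits)
    have "\<theta> j \<noteq> \<theta> (Suc j)" using inj j jN by (auto dest: inj_onD)
    then have opp: "\<theta> (Suc j) = - \<theta> j" using eq jN by (auto simp: \<theta>'_def abs_eq_iff)
    have cis_ne: "cis (\<theta> j) \<noteq> cis (- \<theta> j)"
      using inj_cis j jN unfolding opp[symmetric] by (auto dest: inj_onD)
    \<comment> \<open>Only two angles share an absolute value, and both are already taken by
      \<open>j\<close> and \<open>Suc j\<close>; hence all earlier points are strictly closer to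
      1.\<close>
    have "\<bar>\<theta> k\<bar> < \<bar>\<theta>' j\<bar>" if k: "k < j" for k
    proof -
      have "\<theta> k \<noteq> \<theta> j" "\<theta> k \<noteq> \<theta> (Suc j)" using inj j jN k by (auto dest: inj_onD)
      then have "\<bar>\<theta> k\<bar> \<noteq> \<bar>\<theta> j\<bar>" unfolding opp by (auto simp: abs_eq_iff)
      then show ?thesis using mono[of k j] k j by (simp add: \<theta>'_def)
    qed
    then have da: "dominant_atoms \<mu> (Z j) (cos (\<theta>' j))" using j by (intro dominant) auto
    then interpret D: dominant_atoms \<mu> "Z j" "cos (\<theta>' j)" .
    have \<theta>'j: "\<theta>' j = \<theta> j" using j by (simp add: \<theta>'_def)
    define \<beta>p where "\<beta>p = (\<Prod>k<j. (cmod (cis (\<theta> j) - cis (\<theta> k)))\<^sup>2) * measure \<mu> {cis (\<theta> j)}"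
    define \<beta>m where "\<beta>m = (\<Prod>k<j. (cmod (cis (- \<theta> j) - cis (\<theta> k)))\<^sup>2) * measure \<mu> {cis (- \<theta> j)}"
    define a where "a = \<beta>p / (\<beta>p + \<beta>m)"
    have q2: "(cmod (poly D.q z))\<^sup>2 = (\<Prod>k<j. (cmod (z - cis (\<theta> k)))\<^sup>2)" for z
      unfolding D.poly_q using prod_Z[of j "\<lambda>a. z - a"] j by (simp add: prod_norm[symmetric] prod_power_distrib)
    have D_eq: "(LINT z|\<mu>. indicator {z. Re z = cos (\<theta>' j)} z * (cmod (poly D.q z))\<^sup>2) = \<beta>p + \<beta>m"
      using integral_vertical_line[OF _ cis_ne, of "\<lambda>z. (cmod (poly D.q z))\<^sup>2"]
      by (simp add: \<theta>'j \<beta>p_def \<beta>m_def q2 continuous_intros mult.commute)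
    have E_eq: "(LINT z|\<mu>. indicator {z. Re z = cos (\<theta>' j)} z *\<^sub>R (z * (cmod (poly D.q z))\<^sup>2))
        = \<beta>p * cis (\<theta> j) + \<beta>m * cis (- \<theta> j)"
      using integral_vertical_line[OF _ cis_ne, of "\<lambda>z. z * complex_of_real ((cmod (poly D.q z))\<^sup>2)"]
      by (simp add: \<theta>'j \<beta>p_def \<beta>m_def q2 continuous_intros scaleR_conv_of_real mult_ac)
    have "\<beta>p > 0"
      unfolding \<beta>p_def using inj_cis j atom[OF j]
      by (intro mult_pos_pos prod_pos) (auto dest: inj_onD)
    moreover have "\<beta>m \<ge> 0" unfolding \<beta>m_def by (intro mult_nonneg_nonneg prod_nonneg) auto
    ultimately have pos: "\<beta>p + \<beta>m > 0" by simp
    have quot: "(\<beta>p * cis (\<theta> j) + \<beta>m * cis (- \<theta> j)) / complex_of_real (\<beta>p + \<beta>m) = a * cis (\<theta> j) + (1 - a) * cis (- \<theta> j)"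
    proof -
      have "1 - a = \<beta>m / (\<beta>p + \<beta>m)" using pos by (simp add: a_def field_simps)
      then show ?thesis unfolding a_def by (simp only: of_real_divide of_real_add add_divide_distrib times_divide_eq_left)
    qed
    have "((\<lambda>t. poly (monic_OP (density \<mu> (\<lambda>z. exp (2 * t * (Re z - cos (\<theta>' j))))) (Suc j)) 0)
        \<longlongrightarrow> - poly D.q 0 * (a * cis (\<theta> j) + (1 - a) * cis (- \<theta> j))) at_top"
      using D.tendsto_\<Phi>_1[unfolded D_eq E_eq quot] pos j
      by (simp add: D.\<Phi>_def D.Mt_def D.W_def card_Z)
    then have "((\<lambda>t. verblunsky (tilt \<mu> t) j) \<longlongrightarrow> (\<Prod>k<j. - cis (- \<theta> k)) *
             (complex_of_real a * cis (- \<theta> j) + complex_of_real (1 - a) * cis (\<theta> j))) at_top"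
      by (rule verblunsky_tendsto[OF mu nt]) (use cnj_q[OF _ da] j in \<open>simp add: cis_cnj\<close>)
    then show ?thesis unfolding Let_def a_def \<beta>p_def \<beta>m_def .
  qed

  have part3: "((\<lambda>t. verblunsky (tilt \<mu> t) j) \<longlongrightarrow>
           (-1) * (\<Prod>k\<le>N. - cis (- \<theta> k)) * (- cis (- \<theta>inf)) ^ (j - N)) at_top"
    if j: "j \<ge> Suc N" for j
  proof -
    have \<theta>'N: "\<theta>' (Suc N) = \<theta>inf" by (simp add: \<theta>'_def)
    have "\<bar>\<theta> k\<bar> < \<bar>\<theta>' (Suc N)\<bar>" if "k < Suc N" for k
      using \<theta>(3)[of k] that inf_abs by (simp add: \<theta>'N)
    then have da: "dominant_atoms \<mu> (Z (Suc N)) (cos (\<theta>' (Suc N)))" by (intro dominant) auto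
    then interpret D: dominant_atoms \<mu> "Z (Suc N)" "cos (\<theta>' (Suc N))" .
    have nondeg: "nondegenerate_circle_measure (density \<mu> (indicator {z. Re z > cos (\<theta>' (Suc N)) - \<delta>}))"
      if "\<delta> > 0" for \<delta>
    proof (rule nondegenerate_restriction[OF circle_measure_axioms])
      show op: "open {z. Re z > cos (\<theta>' (Suc N)) - \<delta>}" by (rule open_halfspace_Re_gt)
      have "v \<in> {z. Re z > cos (\<theta>' (Suc N)) - \<delta>}" using that by (simp add: v_def \<theta>'N)
      then obtain e where "e > 0" "ball v e \<subseteq> {z. Re z > cos (\<theta>' (Suc N)) - \<delta>}" by (rule openE[OF op])
      then show "infinite ({z. Re z > cos (\<theta>' (Suc N)) - \<delta>} \<inter> ?T)"
        using v_limit unfolding islimpt_eq_infinite_ball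
        by (metis Int_commute Int_mono infinite_super order_refl)
    qed
    have conc: "\<exists>\<delta>>0. AE z in \<mu>. z \<in> Z (Suc N) \<or> cmod (z - v) < e \<or> Re z \<le> cos (\<theta>' (Suc N)) - \<delta>"
      if e: "e > 0" for e
    proof -
      \<comment> \<open>The support on or left of the line, away from \<open>v\<close>. By
        \<open>inf_unique\<close> this compact set misses the line, so its largest real part leaves
        a gap \<open>\<delta>\<close>.\<close>
      define K where "K = ?T \<inter> {z. Re z \<le> cos \<theta>inf} - ball v e"
      have "compact (?T \<inter> {z. Re z \<le> cos \<theta>inf})"
        using T_compact closed_halfspace_Re_le by (rule compact_Int_closed)
      then have K: "compact K" unfolding K_def by (rule compact_diff) simp
      have K_less: "Re z < cos \<theta>inf" if z: "z \<in> K" for z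
      proof (rule ccontr)
        have zT: "z \<in> ?T" using z by (simp add: K_def)
        assume "\<not> Re z < cos \<theta>inf"
        then have "cos (Arg z) = cos \<theta>inf" using z cis_Arg_T(2)[OF zT] by (simp add: K_def)
        then have "\<bar>Arg z\<bar> = \<bar>\<theta>inf\<bar>"
          using cos_le_cos_iff_abs[OF abs_Arg[of z], of \<theta>inf] cos_le_cos_iff_abs[OF _ abs_Arg[of z], of \<theta>inf]
            Theta_le inf_abs by linarith
        then have "Arg z = \<theta>inf"
          using inf_abs Arg_bounded[of z] zT cis_Arg_T(1)[OF zT] by (intro inf_unique) auto
        then have "z = v" using cis_Arg_T(1)[OF zT] by (simp add: v_def)
        then show False using z e by (simp add: K_def)
      qed
      have "\<exists>\<delta>>0. \<forall>z\<in>K. Re z \<le> cos \<theta>inf - \<delta>"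
      proof (cases "K = {}")
        case False
        then obtain x where x: "x \<in> K" "\<And>y. y \<in> K \<Longrightarrow> Re y \<le> Re x"
          using continuous_attains_sup[OF K, of Re] continuous_on_Re[OF continuous_on_id] by auto
        then show ?thesis using K_less[OF x(1)] by (intro exI[of _ "cos \<theta>inf - Re x"]) auto
      qed (auto intro: exI[of _ 1])
      then obtain \<delta> where \<delta>: "\<delta> > 0" "\<And>z. z \<in> K \<Longrightarrow> Re z \<le> cos \<theta>inf - \<delta>" by blast
      have "AE z in \<mu>. z \<in> Z (Suc N) \<or> cmod (z - v) < e \<or> Re z \<le> cos (\<theta>' (Suc N)) - \<delta>"
        using AE_msupp[OF sets] D.AE_dominated
      proof eventually_elim
        case (elim z)
        then show ?case using \<delta>(2)[of z] by (auto simp: K_def \<theta>'N dist_norm norm_minus_commute)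
      qed
      then show ?thesis using \<delta>(1) by blast
    qed
    have v1: "cmod v = 1" by (simp add: v_def)
    \<comment> \<open>\<open>Suc N\<close> atoms and \<open>m = j - N\<close> add up to the degree
      \<open>Suc j\<close>.\<close>
    have "((\<lambda>t. poly (D.\<Phi> (j - N) t) 0) \<longlongrightarrow> poly D.q 0 * (- v) ^ (j - N)) at_top"
      by (rule D.tendsto_\<Phi>[OF v1 conc nondeg])
    then have "((\<lambda>t. poly (monic_OP (density \<mu> (\<lambda>z. exp (2 * t * (Re z - cos (\<theta>' (Suc N)))))) (Suc j)) 0)
        \<longlongrightarrow> poly D.q 0 * (- v) ^ (j - N)) at_top"
      using j by (simp add: D.\<Phi>_def D.Mt_def D.W_def card_Z)
    then show ?thesis
      by (rule verblunsky_tendsto[OF mu nt])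
         (use cnj_q[OF _ da] in \<open>simp add: lessThan_Suc_atMost v_def cis_cnj\<close>)
  qed

  show ?thesis using part1 part2 part3 by blast
qed

end
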